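(* Let $\Bbbk$ be a field, let $B=\Bbbk^{\oplus3}=\Bbbk e_1\oplus\Bbbk e_2\oplus\Bbbk e_3$ (with pointwise multiplication) be a weak bialgebra, and let $B_s$ and $B_t$ be its source and target counital subalgebras. Then $B$ is isomorphic, as a weak bialgebra, to one of the following. (1) If $\dim B_s=\dim B_t=1$, then $B$ is a bialgebra, and is one of the 7 bialgebras (B1)–(B7) listed in the context. (2) If $\dim B_s=\dim B_t=3$, then $e_1,e_2,e_3$ are group-like elements, i.e. $\Delta(e_i)=e_i\otimes e_i$ and $\varepsilon(e_i)=1$ for $i=1,2,3$. (3) If $\dim B_s=\dim B_t=2$, then $B$ is one of the following 3 structures, each with $\varepsilon(e_1)=\varepsilon(e_2)=1$ and $\varepsilon(e_3)=0$: (3a) $\Delta(e_1)=e_1\otimes e_1$, $\Delta(e_2)=e_2\otimes e_2$, $\Delta(e_3)=e_2\otimes e_3+e_3\otimes e_1$; (3b) $\Delta(e_1)=e_1\otimes e_1$, $\Delta(e_2)=e_2\otimes e_2$, $\Delta(e_3)=e_1\otimes e_3+e_3\otimes e_1+e_3\otimes e_3$; (3c) $\Delta(e_1)=e_1\otimes e_1+e_3\otimes e_3$, $\Delta(e_2)=e_2\otimes e_2$, $\Delta(e_3)=e_1\otimes e_3+e_3\otimes e_1$. As a result, there are exactly 11 non-isomorphic weak bialgebra structures on $B$.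
   Context: The algebra structure on $B$ is $e_ie_j=\delta_{ij}e_i$, $1=e_1+e_2+e_3$. A weak bialgebra is a vector space $B$ with an associative unital algebra structure and a coassociative counital coalgebra structure $(\Delta,\varepsilon)$ such that: (i) $\Delta(xy)=\Delta(x)\Delta(y)$ for all $x,y$ (but $\Delta(1)=1\otimes1$ is not required); (ii) $(\Delta(1)\otimes1)(1\otimes\Delta(1))=(\Delta\otimes\mathrm{id})\Delta(1)=(1\otimes\Delta(1))(\Delta(1)\otimes1)$, and $\varepsilon(xyz)=\sum\varepsilon(xy_{(1)})\varepsilon(y_{(2)}z)=\sum\varepsilon(xy_{(2)})\varepsilon(y_{(1)}z)$ for all $x,y,z$. It is a bialgebra if moreover $\Delta$ and $\varepsilon$ are unital algebra morphisms. An isomorphism of weak bialgebras is a bijective linear map that is both an algebra and a coalgebra morphism. Writing $\Delta(1)=\sum 1_{(1)}\otimes1_{(2)}$, the target counital subalgebra $B_t$ is the image of $\varepsilon_t(x)=\sum\varepsilon(1_{(1)}x)1_{(2)}$ and the source counital subalgebra $B_s$ is the image of $\varepsilon_s(x)=\sum1_{(1)}\varepsilon(x1_{(2)})$. The 7 bialgebras, each with $\varepsilon(e_1)=1$, $\varepsilon(e_2)=\varepsilon(e_3)=0$: (B1) $\Delta(e_1)=e_1\otimes e_1+e_2\otimes e_3+e_3\otimes e_2$, $\Delta(e_2)=e_1\otimes e_2+e_2\otimes e_1+e_3\otimes e_3$, $\Delta(e_3)=e_1\otimes e_3+e_3\otimes e_1+e_2\otimes e_2$. (B2) $\Delta(e_1)=e_1\otimes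 e_1+e_2\otimes e_2$, $\Delta(e_2)=e_1\otimes e_2+e_2\otimes e_1$, $\Delta(e_3)=e_1\otimes e_3+e_3\otimes e_1+e_2\otimes e_3+e_3\otimes e_2+e_3\otimes e_3$. (B3) $\Delta(e_1)=e_1\otimes e_1$, $\Delta(e_2)=e_1\otimes e_2+e_2\otimes e_1+e_2\otimes e_2+e_2\otimes e_3$, $\Delta(e_3)=e_1\otimes e_3+e_3\otimes e_1+e_3\otimes e_2+e_3\otimes e_3$. (B4) $\Delta(e_1)=e_1\otimes e_1$, $\Delta(e_2)=e_1\otimes e_2+e_2\otimes e_1+e_2\otimes e_2+e_3\otimes e_2$, $\Delta(e_3)=e_1\otimes e_3+e_3\otimes e_1+e_2\otimes e_3+e_3\otimes e_3$. (B5) $\Delta(e_1)=e_1\otimes e_1$, $\Delta(e_2)=e_1\otimes e_2+e_2\otimes e_1+e_2\otimes e_2+e_3\otimes e_2+e_2\otimes e_3$, $\Delta(e_3)=e_1\otimes e_3+e_3\otimes e_1+e_3\otimes e_3$. (B6) $\Delta(e_1)=e_1\otimes e_1$, $\Delta(e_2)=e_1\otimes e_2+e_2\otimes e_1+e_2\otimes e_2+e_3\otimes e_2+e_2\otimes e_3+e_3\otimes e_3$, $\Delta(e_3)=e_1\otimes e_3+e_3\otimes e_1$. (B7) $\Delta(e_1)=e_1\otimes e_1$, $\Delta(e_2)=e_1\otimes e_2+e_2\otimes e_1+e_2\otimes e_2+e_3\otimes e_3$, $\Delta(e_3)=e_1\otimes e_3+e_3\otimes e_1+e_3\otimes e_2+e_2\otimes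 e_3$. *)

theory Defs
  imports "HOL-Analysis.Analysis"
begin

text \<open>
  The algebra \<open>k\<^sup>n\<close> is the library type \<open>'k ^ 'n\<close>, whose ring operations \<open>*\<close>, \<open>1\<close> are pointwise.
  The tensor product \<open>k\<^sup>m \<otimes> k\<^sup>n\<close> is modelled by \<open>'k ^ ('m \<times> 'n)\<close>, with basis
  \<open>e\<^sub>i \<otimes> e\<^sub>j = axis (i, j) 1\<close>; the tensor product algebra structure is then again the pointwise one
  (see \<open>tensor_mult\<close>, \<open>tensor_one\<close>), and \<open>lift_tensor_tensor\<close> is the universal property.
\<close>

section \<open>Tensor products of coordinate spaces\<close>

definition tensor :: "'k::field ^ 'm \<Rightarrow> 'k ^ 'n \<Rightarrow> 'k ^ ('m \<times> 'n)" (infixr \<open>\<otimes>\<close> 75)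
  where "x \<otimes> y = (\<chi> p. x $ fst p * y $ snd p)"

text \<open>
  The linear map on \<open>k\<^sup>m \<otimes> k\<^sup>n\<close> induced by a bilinear map \<open>\<beta>\<close>; the codomain is a vector space with
  scalar multiplication \<open>sc\<close>. In Sweedler notation \<open>lift_tensor sc \<beta> (\<Delta> x)\<close> is
  \<open>\<Sum> \<beta> x\<^sub>(\<^sub>1\<^sub>) x\<^sub>(\<^sub>2\<^sub>)\<close>.
\<close>

definition lift_tensor ::
    "('k::field \<Rightarrow> 'v::comm_monoid_add \<Rightarrow> 'v) \<Rightarrow> ('k ^ 'm \<Rightarrow> 'k ^ 'n \<Rightarrow> 'v) \<Rightarrow> 'k ^ ('m \<times> 'n) \<Rightarrow> 'v"
  where "lift_tensor sc \<beta> t = (\<Sum>(i, j)\<in>UNIV. sc (t $ (i, j)) (\<beta> (axis i 1) (axis j 1)))"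

definition tensor_map ::
    "('k::field ^ 'm \<Rightarrow> 'k ^ 'p) \<Rightarrow> ('k ^ 'n \<Rightarrow> 'k ^ 'q) \<Rightarrow> 'k ^ ('m \<times> 'n) \<Rightarrow> 'k ^ ('p \<times> 'q)"
  where "tensor_map f g = lift_tensor (*s) (\<lambda>x y. f x \<otimes> g y)"

definition tensor_assoc :: "'k ^ (('l::finite \<times> 'm::finite) \<times> 'n::finite) \<Rightarrow> 'k ^ ('l \<times> 'm \<times> 'n)"
  where "tensor_assoc t = (\<chi> p. t $ ((fst p, fst (snd p)), snd (snd p)))"

lemma tensor_axis:
  "axis i 1 \<otimes> axis j 1 = (axis (i, j) 1 :: 'k::field ^ ('m::finite \<times> 'n::finite))"
  by (auto simp: tensor_def axis_def vec_eq_iff)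

lemma tensor_mult: "(x \<otimes> y) * (x' \<otimes> y') = (x * x') \<otimes> (y * y')"
  by (simp add: tensor_def vec_eq_iff algebra_simps)

lemma tensor_one: "1 \<otimes> 1 = 1"
  by (simp add: tensor_def vec_eq_iff)

lemma tensor_assoc_tensor: "tensor_assoc ((x \<otimes> y) \<otimes> z) = x \<otimes> (y \<otimes> z)"
  by (simp add: tensor_def tensor_assoc_def vec_eq_iff algebra_simps)

lemma lift_tensor_tensor:
  fixes x :: "'k::field ^ 'm" and y :: "'k ^ 'n" and \<beta> :: "'k ^ 'm \<Rightarrow> 'k ^ 'n \<Rightarrow> 'v::ab_group_add"
  assumes l: "\<And>y. Vector_Spaces.linear (*s) sc (\<lambda>x. \<beta> x y)"
    and r: "\<And>x. Vector_Spaces.linear (*s) sc (\<beta> x)"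
  shows "lift_tensor sc \<beta> (x \<otimes> y) = \<beta> x y"
proof -
  interpret V: vector_space sc
    using r[of 0] by (simp add: Vector_Spaces.linear_def)
  have L: "\<beta> (\<Sum>i\<in>UNIV. c i *s w i) v = (\<Sum>i\<in>UNIV. sc (c i) (\<beta> (w i) v))"
    for c and w :: "'m \<Rightarrow> 'k ^ 'm" and v
  proof -
    interpret Vector_Spaces.linear "(*s)" sc "\<lambda>x. \<beta> x v" by (rule l)
    show ?thesis by (simp add: sum scale)
  qed
  have R: "\<beta> v (\<Sum>i\<in>UNIV. c i *s w i) = (\<Sum>i\<in>UNIV. sc (c i) (\<beta> v (w i)))"
    for c and w :: "'n \<Rightarrow> 'k ^ 'n" and v
  proof -
    interpret Vector_Spaces.linear "(*s)" sc "\<beta> v" by (rule r)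
    show ?thesis by (simp add: sum scale)
  qed
  have "\<beta> x y = \<beta> (\<Sum>i\<in>UNIV. x $ i *s axis i 1) (\<Sum>j\<in>UNIV. y $ j *s axis j 1)"
    by (simp add: basis_expansion)
  also have "\<dots> = (\<Sum>i\<in>UNIV. \<Sum>j\<in>UNIV. sc (x $ i * y $ j) (\<beta> (axis i 1) (axis j 1)))"
    by (simp add: L R V.scale_sum_right mult.commute) (rule sum.swap)
  also have "\<dots> = lift_tensor sc \<beta> (x \<otimes> y)"
    by (simp add: lift_tensor_def tensor_def sum.cartesian_product case_prod_unfold)
  finally show ?thesis by simp
qed

section \<open>Weak bialgebras\<close>

locale coalgebra =
  fixes \<Delta> :: "'k::field ^ 'n \<Rightarrow> 'k ^ ('n \<times> 'n)" and \<epsilon> :: "'k ^ 'n \<Rightarrow> 'k"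
  assumes linear_comult: "Vector_Spaces.linear (*s) (*s) \<Delta>"
    and linear_counit: "Vector_Spaces.linear (*s) (*) \<epsilon>"
    and coassoc: "tensor_assoc (tensor_map \<Delta> id (\<Delta> x)) = tensor_map id \<Delta> (\<Delta> x)"
    and counit_left: "lift_tensor (*s) (\<lambda>a b. \<epsilon> a *s b) (\<Delta> x) = x"
    and counit_right: "lift_tensor (*s) (\<lambda>a b. \<epsilon> b *s a) (\<Delta> x) = x"

locale weak_bialgebra = coalgebra +
  assumes comult_mult: "\<Delta> (x * y) = \<Delta> x * \<Delta> y"
    and weak_unit_left:
      "tensor_assoc (\<Delta> 1 \<otimes> 1) * (1 \<otimes> \<Delta> 1) = tensor_assoc (tensor_map \<Delta> id (\<Delta> 1))"
    and weak_unit_right: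
      "(1 \<otimes> \<Delta> 1) * tensor_assoc (\<Delta> 1 \<otimes> 1) = tensor_assoc (tensor_map \<Delta> id (\<Delta> 1))"
    and weak_counit_left:
      "\<epsilon> (x * y * z) = lift_tensor (*) (\<lambda>a b. \<epsilon> (x * a) * \<epsilon> (b * z)) (\<Delta> y)"
    and weak_counit_right:
      "\<epsilon> (x * y * z) = lift_tensor (*) (\<lambda>a b. \<epsilon> (x * b) * \<epsilon> (a * z)) (\<Delta> y)"

locale bialgebra = weak_bialgebra +
  assumes comult_one: "\<Delta> 1 = 1 \<otimes> 1"
    and counit_mult: "\<epsilon> (x * y) = \<epsilon> x * \<epsilon> y"
    and counit_one: "\<epsilon> 1 = 1"

definition target_subalgebra ::
    "('k::field ^ 'n \<Rightarrow> 'k ^ ('n \<times> 'n)) \<Rightarrow> ('k ^ 'n \<Rightarrow> 'k) \<Rightarrow> ('k ^ 'n) set"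
  where "target_subalgebra \<Delta> \<epsilon> = range (\<lambda>x. lift_tensor (*s) (\<lambda>a b. \<epsilon> (a * x) *s b) (\<Delta> 1))"

definition source_subalgebra ::
    "('k::field ^ 'n \<Rightarrow> 'k ^ ('n \<times> 'n)) \<Rightarrow> ('k ^ 'n \<Rightarrow> 'k) \<Rightarrow> ('k ^ 'n) set"
  where "source_subalgebra \<Delta> \<epsilon> = range (\<lambda>x. lift_tensor (*s) (\<lambda>a b. \<epsilon> (x * b) *s a) (\<Delta> 1))"

definition group_like ::
    "('k::field ^ 'n \<Rightarrow> 'k ^ ('n \<times> 'n)) \<Rightarrow> ('k ^ 'n \<Rightarrow> 'k) \<Rightarrow> 'k ^ 'n \<Rightarrow> bool"
  where "group_like \<Delta> \<epsilon> g \<longleftrightarrow> \<Delta> g = g \<otimes> g \<and> \<epsilon> g = 1"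

text \<open>A weak bialgebra structure on the fixed algebra \<open>k\<^sup>n\<close> is given by the pair \<open>(\<Delta>, \<epsilon>)\<close>.\<close>

type_synonym ('k, 'n) wb_struct =
  "(('k, 'n) vec \<Rightarrow> ('k, 'n \<times> 'n) vec) \<times> (('k, 'n) vec \<Rightarrow> 'k)"

definition wb_isomorphic :: "('k::field, 'n::finite) wb_struct \<Rightarrow> ('k, 'n) wb_struct \<Rightarrow> bool"
    (infix \<open>\<cong>\<^sub>w\<^sub>b\<close> 50)
  where "S \<cong>\<^sub>w\<^sub>b T \<longleftrightarrow> (case (S, T) of ((\<Delta>, \<epsilon>), (\<Delta>', \<epsilon>')) \<Rightarrow>
    (\<exists>f. Vector_Spaces.linear (*s) (*s) f \<and> bij f \<and>
       (\<forall>x y. f (x * y) = f x * f y) \<and> f 1 = 1 \<and>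
       (\<forall>x. \<Delta>' (f x) = tensor_map f f (\<Delta> x)) \<and> (\<forall>x. \<epsilon>' (f x) = \<epsilon> x)))"

definition wb_structures :: "('k::field, 'n::finite) wb_struct set"
  where "wb_structures = {(\<Delta>, \<epsilon>). weak_bialgebra \<Delta> \<epsilon>}"

definition wb_iso_rel :: "(('k::field, 'n::finite) wb_struct \<times> ('k, 'n) wb_struct) set"
  where "wb_iso_rel = {(S, T). S \<in> wb_structures \<and> T \<in> wb_structures \<and> S \<cong>\<^sub>w\<^sub>b T}"

section \<open>The structures on \<open>k\<^sup>3\<close>\<close>

text \<open>In the index type \<open>3\<close> the numerals satisfy \<open>3 = 0\<close>, and \<open>1, 2, 3\<close> are its three elements.\<close>

abbreviation e1 :: "'k::field ^ 3" where "e1 \<equiv> axis 1 1"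
abbreviation e2 :: "'k::field ^ 3" where "e2 \<equiv> axis 2 1"
abbreviation e3 :: "'k::field ^ 3" where "e3 \<equiv> axis 3 1"

text \<open>
  \<open>struct_of_basis (d\<^sub>1, d\<^sub>2, d\<^sub>3) (c\<^sub>1, c\<^sub>2, c\<^sub>3)\<close> is the linear extension of
  \<open>\<Delta> e\<^sub>i = d\<^sub>i\<close>, \<open>\<epsilon> e\<^sub>i = c\<^sub>i\<close>.
\<close>

fun struct_of_basis ::
    "('k::field ^ (3 \<times> 3)) \<times> ('k ^ (3 \<times> 3)) \<times> ('k ^ (3 \<times> 3)) \<Rightarrow> 'k \<times> 'k \<times> 'k \<Rightarrow> ('k, 3) wb_struct"
  where "struct_of_basis (d1, d2, d3) (c1, c2, c3) =
    ((\<lambda>x. x $ 1 *s d1 + x $ 2 *s d2 + x $ 3 *s d3),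
     (\<lambda>x. x $ 1 * c1 + x $ 2 * c2 + x $ 3 * c3))"

definition B1 :: "('k::field, 3) wb_struct" where
  "B1 = struct_of_basis
    (e1 \<otimes> e1 + e2 \<otimes> e3 + e3 \<otimes> e2,
     e1 \<otimes> e2 + e2 \<otimes> e1 + e3 \<otimes> e3,
     e1 \<otimes> e3 + e3 \<otimes> e1 + e2 \<otimes> e2) (1, 0, 0)"

definition B2 :: "('k::field, 3) wb_struct" where
  "B2 = struct_of_basis
    (e1 \<otimes> e1 + e2 \<otimes> e2,
     e1 \<otimes> e2 + e2 \<otimes> e1,
     e1 \<otimes> e3 + e3 \<otimes> e1 + e2 \<otimes> e3 + e3 \<otimes> e2 + e3 \<otimes> e3) (1, 0, 0)"

definition B3 :: "('k::field, 3) wb_struct" where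
  "B3 = struct_of_basis
    (e1 \<otimes> e1,
     e1 \<otimes> e2 + e2 \<otimes> e1 + e2 \<otimes> e2 + e2 \<otimes> e3,
     e1 \<otimes> e3 + e3 \<otimes> e1 + e3 \<otimes> e2 + e3 \<otimes> e3) (1, 0, 0)"

definition B4 :: "('k::field, 3) wb_struct" where
  "B4 = struct_of_basis
    (e1 \<otimes> e1,
     e1 \<otimes> e2 + e2 \<otimes> e1 + e2 \<otimes> e2 + e3 \<otimes> e2,
     e1 \<otimes> e3 + e3 \<otimes> e1 + e2 \<otimes> e3 + e3 \<otimes> e3) (1, 0, 0)"

definition B5 :: "('k::field, 3) wb_struct" where
  "B5 = struct_of_basis
    (e1 \<otimes> e1,
     e1 \<otimes> e2 + e2 \<otimes> e1 + e2 \<otimes> e2 + e3 \<otimes> e2 + e2 \<otimes> e3,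
     e1 \<otimes> e3 + e3 \<otimes> e1 + e3 \<otimes> e3) (1, 0, 0)"

definition B6 :: "('k::field, 3) wb_struct" where
  "B6 = struct_of_basis
    (e1 \<otimes> e1,
     e1 \<otimes> e2 + e2 \<otimes> e1 + e2 \<otimes> e2 + e3 \<otimes> e2 + e2 \<otimes> e3 + e3 \<otimes> e3,
     e1 \<otimes> e3 + e3 \<otimes> e1) (1, 0, 0)"

definition B7 :: "('k::field, 3) wb_struct" where
  "B7 = struct_of_basis
    (e1 \<otimes> e1,
     e1 \<otimes> e2 + e2 \<otimes> e1 + e2 \<otimes> e2 + e3 \<otimes> e3,
     e1 \<otimes> e3 + e3 \<otimes> e1 + e3 \<otimes> e2 + e2 \<otimes> e3) (1, 0, 0)"

definition W3 :: "('k::field, 3) wb_struct" where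
  "W3 = struct_of_basis (e1 \<otimes> e1, e2 \<otimes> e2, e3 \<otimes> e3) (1, 1, 1)"

definition W2a :: "('k::field, 3) wb_struct" where
  "W2a = struct_of_basis
    (e1 \<otimes> e1,
     e2 \<otimes> e2,
     e2 \<otimes> e3 + e3 \<otimes> e1) (1, 1, 0)"

definition W2b :: "('k::field, 3) wb_struct" where
  "W2b = struct_of_basis
    (e1 \<otimes> e1,
     e2 \<otimes> e2,
     e1 \<otimes> e3 + e3 \<otimes> e1 + e3 \<otimes> e3) (1, 1, 0)"

definition W2c :: "('k::field, 3) wb_struct" where
  "W2c = struct_of_basis
    (e1 \<otimes> e1 + e3 \<otimes> e3,
     e2 \<otimes> e2,
     e1 \<otimes> e3 + e3 \<otimes> e1) (1, 1, 0)"

end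

theory Submission
  imports Defs
begin

text \<open>
  Why the classification holds. On \<open>k\<^sup>n\<close> multiplicativity of \<open>\<Delta>\<close> says that the coefficients of the
  \<open>\<Delta> e\<^sub>k\<close> at a fixed \<open>e\<^sub>i \<otimes> e\<^sub>j\<close> are pairwise orthogonal idempotents of the field: they are \<open>0\<close> or
  \<open>1\<close>, and at most one of them is \<open>1\<close>. So \<open>\<Delta>\<close> is a partial binary operation on the index set,
  where \<open>ij = k\<close> means that \<open>e\<^sub>i \<otimes> e\<^sub>j\<close> occurs in \<open>\<Delta> e\<^sub>k\<close>. Weak multiplicativity of the counit
  forces \<open>\<epsilon>\<close> to be the indicator of a set of indices. The other axioms then say precisely that the
  indices are the arrows of a small category with this composition, whose identity arrows are the
  indices at which \<open>\<epsilon>\<close> is \<open>1\<close>: coassociativity is associativity, the weak unit axiom says that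
  \<open>(ij)k\<close> is defined as soon as \<open>ij\<close> and \<open>jk\<close> are, and the counit laws are the unit laws. Thus weak
  bialgebra structures on \<open>k\<^sup>n\<close> are the function algebras of categories with \<open>n\<close> arrows
  (\<open>weak_bialgebra_of_category\<close>, \<open>category_of_weak_bialgebra\<close>).

  Under this dictionary \<open>B\<^sub>s\<close> and \<open>B\<^sub>t\<close> consist of the functions that factor through the source
  and through the target map, so both have the number of objects as dimension
  (\<open>dim_source_subalgebra\<close>, \<open>dim_target_subalgebra\<close>). Algebra automorphisms of \<open>k\<^sup>n\<close> permute the
  coordinates, hence isomorphic structures are those of isomorphic categories
  (\<open>cat_structs_isomorphic_iff\<close>).

  It remains to classify categories with three arrows (\<open>three_arrow_classification\<close>). One object
  means a monoid of order three; of these there are seven. With two objects there is a single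
  arrow besides the identities: it joins the two objects, or it is a loop that is idempotent or an
  involution. Three objects leave only identities. The eleven tables are told apart by three
  numbers that relabelling preserves (\<open>profiles\<close>), and this gives the count of isomorphism classes.
\<close>

section \<open>Coordinates in tensor products\<close>

text \<open>
  Sums weighted by indicator functions are kept as sums over the whole index type: terms then keep
  one shape, whether the indicator comes from a composition table or from a basis vector.
\<close>
declare sum_of_bool_mult_eq [simp del] sum_mult_of_bool_eq [simp del]

lemma linear_on_axes:
  fixes f :: "'k::field ^ 'm::finite \<Rightarrow> 'k ^ 'n"
  assumes "Vector_Spaces.linear (*s) (*s) f"
  shows "f x $ j = (\<Sum>i\<in>UNIV. x $ i * f (axis i 1) $ j)"
proof -
  interpret Vector_Spaces.linear "(*s)" "(*s)" f by (rule assms)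
  have "f x $ j = f (\<Sum>i\<in>UNIV. x $ i *s axis i 1) $ j" by (simp add: basis_expansion)
  also have "\<dots> = (\<Sum>i\<in>UNIV. x $ i * f (axis i 1) $ j)" by (simp add: sum scale)
  finally show ?thesis .
qed

lemma linear_functional_on_axes:
  fixes f :: "'k::field ^ 'm::finite \<Rightarrow> 'k"
  assumes "Vector_Spaces.linear (*s) (*) f"
  shows "f x = (\<Sum>i\<in>UNIV. x $ i * f (axis i 1))"
proof -
  interpret Vector_Spaces.linear "(*s)" "(*)" f by (rule assms)
  have "f x = f (\<Sum>i\<in>UNIV. x $ i *s axis i 1)" by (simp add: basis_expansion)
  also have "\<dots> = (\<Sum>i\<in>UNIV. x $ i * f (axis i 1))" by (simp add: sum scale)
  finally show ?thesis .
qed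

lemma axis_one_nth: "axis i (1::'k::field) $ j = of_bool (j = i)"
  by (simp add: axis_def)

lemma sum_of_bool_mult:
  fixes g :: "'a::finite \<Rightarrow> 'k::field"
  shows "(\<Sum>i\<in>UNIV. of_bool (i = a) * g i) = g a" "(\<Sum>i\<in>UNIV. g i * of_bool (i = a)) = g a"
    "(\<Sum>i\<in>UNIV. of_bool (a = i) * g i) = g a" "(\<Sum>i\<in>UNIV. g i * of_bool (a = i)) = g a"
  by (simp_all add: of_bool_def if_distrib if_distribR cong: if_cong)

lemma lift_tensor_nth:
  fixes t :: "'k::field ^ ('m::finite \<times> 'n::finite)"
  shows "lift_tensor (*s) \<beta> t $ l = (\<Sum>i\<in>UNIV. \<Sum>j\<in>UNIV. t $ (i, j) * \<beta> (axis i 1) (axis j 1) $ l)"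
  by (simp add: lift_tensor_def sum.cartesian_product case_prod_unfold)

lemma lift_tensor_scalar:
  fixes t :: "'k::field ^ ('m::finite \<times> 'n::finite)"
  shows "lift_tensor (*) \<beta> t = (\<Sum>i\<in>UNIV. \<Sum>j\<in>UNIV. t $ (i, j) * \<beta> (axis i 1) (axis j 1))"
  by (simp add: lift_tensor_def sum.cartesian_product case_prod_unfold)

lemma tensor_map_nth:
  fixes t :: "'k::field ^ ('m::finite \<times> 'n::finite)"
  shows "tensor_map f g t $ (i, j) =
    (\<Sum>p\<in>UNIV. \<Sum>q\<in>UNIV. t $ (p, q) * (f (axis p 1) $ i * g (axis q 1) $ j))"
  by (simp add: tensor_map_def lift_tensor_nth tensor_def)

lemma tensor_map_id_right_nth:
  fixes t :: "'k::field ^ ('m::finite \<times> 'n::finite)"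
  shows "tensor_map f id t $ (i, k) = (\<Sum>p\<in>UNIV. f (axis p 1) $ i * t $ (p, k))"
proof -
  have "(\<Sum>q\<in>UNIV. t $ (p, q) * (f (axis p 1) $ i * axis q 1 $ k)) = f (axis p 1) $ i * t $ (p, k)" for p
    by (simp add: axis_one_nth sum_of_bool_mult flip: mult.assoc)
  then show ?thesis by (simp add: tensor_map_nth)
qed

lemma tensor_map_id_left_nth:
  fixes t :: "'k::field ^ ('m::finite \<times> 'n::finite)"
  shows "tensor_map id f t $ (i, k) = (\<Sum>q\<in>UNIV. f (axis q 1) $ k * t $ (i, q))"
proof -
  have "(\<Sum>p\<in>UNIV. t $ (p, q) * (axis p 1 $ i * f (axis q 1) $ k)) = f (axis q 1) $ k * t $ (i, q)" for q
    by (simp add: axis_one_nth sum_of_bool_mult mult.left_commute)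
  then show ?thesis by (subst tensor_map_nth, subst sum.swap) simp
qed

section \<open>The function algebra of a composition table\<close>

text \<open>
  A composition table is a set of triples \<open>(i, j, k)\<close>, read \<open>ij = k\<close>. The coproduct is dual to
  composition, \<open>(\<Delta> x)(i, j) = x(ij)\<close>, and vanishes at pairs without composite. As a sum over all
  \<open>k\<close> with \<open>ij = k\<close> it makes sense, and is linear, for every set of triples.
\<close>
definition cat_comult :: "('n \<times> 'n \<times> 'n) set \<Rightarrow> 'k::field ^ 'n::finite \<Rightarrow> 'k ^ ('n \<times> 'n)"
  where "cat_comult M x = (\<chi> p. \<Sum>k\<in>UNIV. of_bool ((fst p, snd p, k) \<in> M) * x $ k)"

definition cat_counit :: "'n set \<Rightarrow> 'k::field ^ 'n::finite \<Rightarrow> 'k"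
  where "cat_counit A x = (\<Sum>i\<in>UNIV. of_bool (i \<in> A) * x $ i)"

lemma linear_cat_comult: "Vector_Spaces.linear (*s) (*s) (cat_comult M :: 'k::field ^ 'n::finite \<Rightarrow> _)"
  by (auto simp: Vector_Spaces.linear_iff vec.vector_space_axioms vec_eq_iff cat_comult_def algebra_simps
      sum.distrib sum_distrib_left)

lemma linear_cat_counit: "Vector_Spaces.linear (*s) (*) (cat_counit A :: 'k::field ^ 'n::finite \<Rightarrow> 'k)"
  by (auto simp: Vector_Spaces.linear_iff vec.vector_space_axioms cat_counit_def algebra_simps
      sum.distrib sum_distrib_left intro!: vector_space.intro)

lemma cat_comult_axis: "cat_comult M (axis k 1) $ (i, j) = of_bool ((i, j, k) \<in> M)"
  by (simp add: cat_comult_def axis_one_nth sum_of_bool_mult)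

lemma cat_counit_mult_axis:
  "cat_counit A (x * axis i 1) = of_bool (i \<in> A) * x $ i"
  "cat_counit A (axis i 1 * x) = of_bool (i \<in> A) * x $ i"
proof -
  have "cat_counit A (x * axis i 1) = (\<Sum>k\<in>UNIV. (of_bool (k \<in> A) * x $ k) * of_bool (k = i))"
    by (simp only: cat_counit_def axis_one_nth vector_mult_component mult.assoc)
  then show "cat_counit A (x * axis i 1) = of_bool (i \<in> A) * x $ i"
    by (simp only: sum_of_bool_mult)
  then show "cat_counit A (axis i 1 * x) = of_bool (i \<in> A) * x $ i"
    by (simp only: mult.commute[of "axis i 1"])
qed

lemma cat_counit_axis: "cat_counit A (axis i 1) = of_bool (i \<in> A)"
  by (simp add: cat_counit_def axis_one_nth sum_of_bool_mult)

text \<open>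
  Both orders of the weak unit axiom multiply the same two coordinates because the algebra is
  commutative; for \<open>t = \<Delta> 1\<close> the product is \<open>1\<close> exactly when \<open>ij\<close> and \<open>jk\<close> are defined.
\<close>
lemma weak_unit_pattern_nth:
  fixes t :: "'k::field ^ ('n::finite \<times> 'n)"
  shows "(tensor_assoc (t \<otimes> 1) * (1 \<otimes> t)) $ (i, j, k) = t $ (i, j) * t $ (j, k)"
    and "((1 \<otimes> t) * tensor_assoc (t \<otimes> 1)) $ (i, j, k) = t $ (i, j) * t $ (j, k)"
  by (simp_all add: tensor_assoc_def tensor_def)

locale partial_operation =
  fixes M :: "('n::finite \<times> 'n \<times> 'n) set"
  assumes composite_unique: "\<lbrakk>(i, j, k) \<in> M; (i, j, k') \<in> M\<rbrakk> \<Longrightarrow> k = k'"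
begin

lemma cat_comult_composite:
  assumes "(i, j, k) \<in> M"
  shows "cat_comult M x $ (i, j) = x $ k"
proof -
  have "(i, j, k') \<in> M \<longleftrightarrow> k' = k" for k' using assms composite_unique by blast
  then show ?thesis by (simp add: cat_comult_def sum_of_bool_mult)
qed

lemma cat_comult_no_composite: "\<nexists>k. (i, j, k) \<in> M \<Longrightarrow> cat_comult M x $ (i, j) = 0"
  by (simp add: cat_comult_def)

lemma sum_over_composite:
  fixes y :: "'n \<Rightarrow> 'k::field"
  assumes "(i, j, p) \<in> M"
  shows "(\<Sum>p\<in>UNIV. of_bool ((i, j, p) \<in> M) * y p) = y p"
proof -
  have "(i, j, p') \<in> M \<longleftrightarrow> p' = p" for p' using assms composite_unique by blast
  then show ?thesis by (simp add: sum_of_bool_mult)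
qed

text \<open>
  The coefficient of \<open>x\<^sub>l\<close> at \<open>e\<^sub>i \<otimes> e\<^sub>j \<otimes> e\<^sub>k\<close> records whether \<open>(ij)k = l\<close>, and in the next lemma
  whether \<open>i(jk) = l\<close>. Comparing the two is how coassociativity becomes associativity. Uniqueness
  of composites is what makes the sum over the intermediate arrow collapse to its existence.
\<close>
lemma cat_comult_left_iterate:
  shows "tensor_map (cat_comult M) id (cat_comult M x) $ ((i, j), k) =
    (\<Sum>l\<in>UNIV. of_bool (\<exists>p. (i, j, p) \<in> M \<and> (p, k, l) \<in> M) * x $ l)"
proof (cases "\<exists>p. (i, j, p) \<in> M")
  case True
  then obtain p where p: "(i, j, p) \<in> M" by blast
  have "(\<exists>p'. (i, j, p') \<in> M \<and> (p', k, l) \<in> M) \<longleftrightarrow> (p, k, l) \<in> M" for l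
    using p composite_unique by blast
  then show ?thesis
    by (simp add: tensor_map_id_right_nth cat_comult_axis sum_over_composite[OF p])
      (simp add: cat_comult_def)
next
  case False
  then show ?thesis by (simp add: tensor_map_id_right_nth cat_comult_axis)
qed

lemma cat_comult_right_iterate:
  shows "tensor_map id (cat_comult M) (cat_comult M x) $ (i, j, k) =
    (\<Sum>l\<in>UNIV. of_bool (\<exists>q. (j, k, q) \<in> M \<and> (i, q, l) \<in> M) * x $ l)"
proof (cases "\<exists>q. (j, k, q) \<in> M")
  case True
  then obtain q where q: "(j, k, q) \<in> M" by blast
  have "(\<exists>q'. (j, k, q') \<in> M \<and> (i, q', l) \<in> M) \<longleftrightarrow> (i, q, l) \<in> M" for l
    using q composite_unique by blast
  then show ?thesis
    by (simp add: tensor_map_id_left_nth cat_comult_axis sum_over_composite[OF q])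
      (simp add: cat_comult_def)
next
  case False
  then show ?thesis by (simp add: tensor_map_id_left_nth cat_comult_axis)
qed

lemma cat_comult_one:
  shows "cat_comult M 1 $ (i, j) = of_bool (\<exists>k. (i, j, k) \<in> M)"
  by (cases "\<exists>k. (i, j, k) \<in> M") (auto simp: cat_comult_composite cat_comult_no_composite)

lemma cat_comult_one_left_iterate:
  shows "tensor_map (cat_comult M) id (cat_comult M 1) $ ((i, j), k) =
    (of_bool (\<exists>p l. (i, j, p) \<in> M \<and> (p, k, l) \<in> M) :: 'k::field)"
proof (cases "\<exists>p. (i, j, p) \<in> M")
  case True
  then obtain p where p: "(i, j, p) \<in> M" by blast
  have "(\<exists>p' l. (i, j, p') \<in> M \<and> (p', k, l) \<in> M) \<longleftrightarrow> (\<exists>l. (p, k, l) \<in> M)"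
    using p composite_unique by blast
  then show ?thesis
    by (simp add: tensor_map_id_right_nth cat_comult_axis sum_over_composite[OF p] cat_comult_one)
next
  case False
  then show ?thesis by (simp add: tensor_map_id_right_nth cat_comult_axis)
qed

end

text \<open>
  Contracting one leg of a tensor with the counit, twisted by an element \<open>x\<close>. For \<open>x = 1\<close> these are
  the two sides of the counit laws; for \<open>t = \<Delta> 1\<close> they are the maps \<open>\<epsilon>\<^sub>s\<close> and \<open>\<epsilon>\<^sub>t\<close>.
\<close>
lemma source_contraction:
  "lift_tensor (*s) (\<lambda>a b. cat_counit A (x * b) *s a) t $ l =
    (\<Sum>j\<in>UNIV. of_bool (j \<in> A) * x $ j * t $ (l, j))"
proof -
  have "(\<Sum>i\<in>UNIV. t $ (i, j) * (of_bool (j \<in> A) * x $ j * of_bool (l = i)))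
      = of_bool (j \<in> A) * x $ j * t $ (l, j)" for j
    by (subst mult.assoc[symmetric], subst sum_of_bool_mult) (rule mult.commute)
  then show ?thesis
    by (subst lift_tensor_nth, subst sum.swap)
     (simp only: vector_smult_component cat_counit_mult_axis axis_one_nth)
qed

lemma target_contraction:
  "lift_tensor (*s) (\<lambda>a b. cat_counit A (a * x) *s b) t $ l =
    (\<Sum>i\<in>UNIV. of_bool (i \<in> A) * x $ i * t $ (i, l))"
proof -
  have "(\<Sum>j\<in>UNIV. t $ (i, j) * (of_bool (i \<in> A) * x $ i * of_bool (l = j)))
      = of_bool (i \<in> A) * x $ i * t $ (i, l)" for i
    by (subst mult.assoc[symmetric], subst sum_of_bool_mult) (rule mult.commute)
  then show ?thesis
    by (simp only: lift_tensor_nth vector_smult_component cat_counit_mult_axis axis_one_nth)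
qed

lemma cat_counit_left_contraction:
  "lift_tensor (*s) (\<lambda>a b. cat_counit A a *s b) t $ l = (\<Sum>i\<in>UNIV. of_bool (i \<in> A) * t $ (i, l))"
  using target_contraction[of A 1 t l] by simp

lemma cat_counit_right_contraction:
  "lift_tensor (*s) (\<lambda>a b. cat_counit A b *s a) t $ l = (\<Sum>j\<in>UNIV. of_bool (j \<in> A) * t $ (l, j))"
  using source_contraction[of A 1 t l] by simp

section \<open>Categories without objects\<close>

text \<open>
  A small category given by its arrows only: objects are represented by the identity arrows, which
  form \<open>A\<close>. The left identity and
  the right identity of an arrow stand for its two end objects. The axiom \<open>composable\<close> is what
  separates categories from arbitrary associative partial operations: the composite of \<open>ij\<close> with
  \<open>k\<close> exists whenever the end objects match.
\<close>
locale arrow_category = partial_operation M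
  for M :: "('n::finite \<times> 'n \<times> 'n) set" +
  fixes A :: "'n set"
  assumes assoc: "(\<exists>p. (i, j, p) \<in> M \<and> (p, k, l) \<in> M) \<longleftrightarrow> (\<exists>q. (j, k, q) \<in> M \<and> (i, q, l) \<in> M)"
    and composable: "\<lbrakk>(i, j, p) \<in> M; (j, k, q) \<in> M\<rbrakk> \<Longrightarrow> \<exists>l. (p, k, l) \<in> M"
    and left_identity_ex: "\<exists>u\<in>A. (u, k, k) \<in> M"
    and right_identity_ex: "\<exists>u\<in>A. (k, u, k) \<in> M"
    and left_identity: "\<lbrakk>u \<in> A; (u, k, l) \<in> M\<rbrakk> \<Longrightarrow> l = k"
    and right_identity: "\<lbrakk>u \<in> A; (k, u, l) \<in> M\<rbrakk> \<Longrightarrow> l = k"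
begin

lemma identity_idem: "u \<in> A \<Longrightarrow> (u, u, u) \<in> M"
  using left_identity_ex[of u] right_identity by metis

lemma identities_composable_eq: "\<lbrakk>u \<in> A; v \<in> A; (u, v, w) \<in> M\<rbrakk> \<Longrightarrow> u = v"
  using left_identity right_identity by metis

text \<open>
  If \<open>u\<close> and \<open>v\<close> are both left identities of \<open>k\<close> then \<open>u(vk) = k\<close>, so associativity provides a
  composite \<open>uv\<close>; but distinct identities do not compose.
\<close>
lemma left_identity_unique:
  assumes "u \<in> A" "v \<in> A" "(u, k, l) \<in> M" "(v, k, l') \<in> M"
  shows "u = v"
proof -
  have "(u, k, k) \<in> M" "(v, k, k) \<in> M" using assms left_identity by metis+
  then have "\<exists>p. (u, v, p) \<in> M \<and> (p, k, k) \<in> M" using assoc[of u v k k] by blast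
  then show ?thesis using identities_composable_eq assms by blast
qed

lemma right_identity_unique:
  assumes "u \<in> A" "v \<in> A" "(k, u, l) \<in> M" "(k, v, l') \<in> M"
  shows "u = v"
proof -
  have "(k, u, k) \<in> M" "(k, v, k) \<in> M" using assms right_identity by metis+
  then have "\<exists>q. (u, v, q) \<in> M \<and> (k, q, k) \<in> M" using assoc[of k u v k] by blast
  then show ?thesis using identities_composable_eq assms by blast
qed

lemma composable_cong:
  assumes "(i, j, p) \<in> M"
  shows "(\<exists>l. (p, k, l) \<in> M) \<longleftrightarrow> (\<exists>q. (j, k, q) \<in> M)"
  using assms assoc composable by metis

end

context arrow_category
begin

section \<open>From categories to weak bialgebras\<close>

lemma comult_on_identities:
  assumes "a \<in> A" "b \<in> A"
  shows "cat_comult M y $ (a, b) = of_bool (a = b) * y $ a"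
proof (cases "a = b")
  case True
  then show ?thesis using cat_comult_composite[OF identity_idem] assms by simp
next
  case False
  then have "\<nexists>k. (a, b, k) \<in> M" using identities_composable_eq assms by blast
  then show ?thesis using False by (simp add: cat_comult_no_composite)
qed

text \<open>
  The counit evaluates only at identity arrows, and there the table is diagonal, so the double sum
  in the weak counit axiom runs over pairs of equal identities.
\<close>
lemma weak_counit_sum:
  fixes x y z :: "'k::field ^ 'n"
  shows "(\<Sum>a\<in>UNIV. \<Sum>b\<in>UNIV. cat_comult M y $ (a, b) * (of_bool (a \<in> A) * x $ a * (of_bool (b \<in> A) * z $ b)))
    = cat_counit A (x * y * z)"
proof -
  have "cat_comult M y $ (a, b) * (of_bool (a \<in> A) * x $ a * (of_bool (b \<in> A) * z $ b))
      = of_bool (b = a) * (of_bool (b \<in> A) * (x $ b * y $ b * z $ b))" for a b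
    by (cases "a \<in> A"; cases "b \<in> A") (auto simp: comult_on_identities)
  then show ?thesis
    by (simp only: sum_of_bool_mult cat_counit_def vector_mult_component)
qed

lemma sum_left_identity:
  fixes x :: "'k::field ^ 'n"
  shows "(\<Sum>i\<in>UNIV. of_bool (i \<in> A) * cat_comult M x $ (i, l)) = x $ l"
proof -
  obtain u where u: "u \<in> A" "(u, l, l) \<in> M" using left_identity_ex by blast
  have "of_bool (i \<in> A) * cat_comult M x $ (i, l) = of_bool (i = u) * x $ l" for i
  proof (cases "i = u")
    case True
    then show ?thesis using u cat_comult_composite[OF u(2)] by simp
  next
    case False
    then have "i \<in> A \<Longrightarrow> \<nexists>k. (i, l, k) \<in> M" using left_identity_unique u by blast
    then show ?thesis using False by (auto simp: cat_comult_no_composite)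
  qed
  then show ?thesis by (simp add: sum_of_bool_mult)
qed

lemma sum_right_identity:
  fixes x :: "'k::field ^ 'n"
  shows "(\<Sum>i\<in>UNIV. of_bool (i \<in> A) * cat_comult M x $ (l, i)) = x $ l"
proof -
  obtain u where u: "u \<in> A" "(l, u, l) \<in> M" using right_identity_ex by blast
  have "of_bool (i \<in> A) * cat_comult M x $ (l, i) = of_bool (i = u) * x $ l" for i
  proof (cases "i = u")
    case True
    then show ?thesis using u cat_comult_composite[OF u(2)] by simp
  next
    case False
    then have "i \<in> A \<Longrightarrow> \<nexists>k. (l, i, k) \<in> M" using right_identity_unique u by blast
    then show ?thesis using False by (auto simp: cat_comult_no_composite)
  qed
  then show ?thesis by (simp add: sum_of_bool_mult)
qed

theorem weak_bialgebra_of_category: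
  "weak_bialgebra (cat_comult M) (cat_counit A :: 'k::field ^ 'n \<Rightarrow> 'k)"
proof (intro weak_bialgebra.intro coalgebra.intro weak_bialgebra_axioms.intro)
  show "Vector_Spaces.linear (*s) (*s) (cat_comult M :: 'k ^ 'n \<Rightarrow> _)" by (rule linear_cat_comult)
  show "Vector_Spaces.linear (*s) (*) (cat_counit A :: 'k ^ 'n \<Rightarrow> _)" by (rule linear_cat_counit)
  fix x y z :: "'k ^ 'n"
  show "tensor_assoc (tensor_map (cat_comult M) id (cat_comult M x)) = tensor_map id (cat_comult M) (cat_comult M x)"
    by (simp add: vec_eq_iff tensor_assoc_def cat_comult_left_iterate
        cat_comult_right_iterate assoc)
  show "lift_tensor (*s) (\<lambda>a b. cat_counit A a *s b) (cat_comult M x) = x"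
    by (simp add: vec_eq_iff cat_counit_left_contraction sum_left_identity)
  show "lift_tensor (*s) (\<lambda>a b. cat_counit A b *s a) (cat_comult M x) = x"
    by (simp add: vec_eq_iff cat_counit_right_contraction sum_right_identity)
  have "cat_comult M (x * y) $ (i, j) = (cat_comult M x * cat_comult M y) $ (i, j)" for i j
    by (cases "\<exists>k. (i, j, k) \<in> M")
      (auto simp: cat_comult_composite cat_comult_no_composite)
  then show "cat_comult M (x * y) = cat_comult M x * cat_comult M y"
    by (simp add: vec_eq_iff)
  have "cat_comult M 1 $ (i, j) * cat_comult M 1 $ (j, k)
      = tensor_map (cat_comult M) id (cat_comult M (1 :: 'k ^ 'n)) $ ((i, j), k)" for i j k
    using composable_cong[of i j _ k]
    by (auto simp: cat_comult_one_left_iterate cat_comult_one)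
  then show "tensor_assoc (cat_comult M 1 \<otimes> 1) * (1 \<otimes> cat_comult M 1)
      = tensor_assoc (tensor_map (cat_comult M) id (cat_comult M (1 :: 'k ^ 'n)))"
    and "(1 \<otimes> cat_comult M 1) * tensor_assoc (cat_comult M 1 \<otimes> 1)
      = tensor_assoc (tensor_map (cat_comult M) id (cat_comult M (1 :: 'k ^ 'n)))"
    by (simp_all only: vec_eq_iff split_paired_All weak_unit_pattern_nth)
      (simp_all add: tensor_assoc_def)
  show "cat_counit A (x * y * z) =
      lift_tensor (*) (\<lambda>a b. cat_counit A (x * a) * cat_counit A (b * z)) (cat_comult M y)"
    by (simp only: lift_tensor_scalar cat_counit_mult_axis weak_counit_sum)
  show "cat_counit A (x * y * z) =
      lift_tensor (*) (\<lambda>a b. cat_counit A (x * b) * cat_counit A (a * z)) (cat_comult M y)"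
    using weak_counit_sum[of y z x]
    by (simp only: lift_tensor_scalar cat_counit_mult_axis mult_ac)
qed

end

section \<open>From weak bialgebras to categories\<close>

text \<open>
  The table and the identities are read off from the basis vectors. The counit laws only say that
  certain numbers of identities, taken in the field, are \<open>0\<close> or \<open>1\<close>; in positive characteristic
  such a number does not determine the cardinality. This is why uniqueness of the left and right
  identity is derived first, from the weak counit axiom and associativity.
\<close>
theorem category_of_weak_bialgebra:
  fixes \<Delta> :: "'k::field ^ 'n::finite \<Rightarrow> 'k ^ ('n \<times> 'n)" and \<epsilon> :: "'k ^ 'n \<Rightarrow> 'k"
  assumes "weak_bialgebra \<Delta> \<epsilon>"
  obtains M A where "arrow_category M A" "\<Delta> = cat_comult M" "\<epsilon> = cat_counit A"
proof -
  interpret weak_bialgebra \<Delta> \<epsilon> by (rule assms)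
  define M where "M = {(i, j, k). \<Delta> (axis k 1) $ (i, j) = 1}"
  define A where "A = {i. \<epsilon> (axis i 1) = 1}"
  have axis_mult: "axis k 1 * axis l 1 = (of_bool (k = l) *s axis k 1 :: 'k ^ 'n)" for k l
    by (auto simp: vec_eq_iff axis_def)
  interpret D: Vector_Spaces.linear "(*s)" "(*s)" \<Delta> by (rule linear_comult)
  interpret E: Vector_Spaces.linear "(*s)" "(*)" \<epsilon> by (rule linear_counit)
  \<comment> \<open>Basis vectors are orthogonal idempotents and \<open>\<Delta>\<close> is multiplicative.\<close>
  have orth: "\<Delta> (axis k 1) $ p * \<Delta> (axis l 1) $ p = of_bool (k = l) * \<Delta> (axis k 1) $ p" for k l p
  proof -
    have "\<Delta> (axis k 1) $ p * \<Delta> (axis l 1) $ p = \<Delta> (axis k 1 * axis l 1) $ p"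
      by (simp add: comult_mult)
    then show ?thesis by (simp add: axis_mult D.scale)
  qed
  have M: "\<Delta> (axis k 1) $ (i, j) = of_bool ((i, j, k) \<in> M)" for i j k
    using orth[of k "(i, j)" k] by (auto simp: M_def)
  have fn: "k = k'" if "(i, j, k) \<in> M" "(i, j, k') \<in> M" for i j k k'
    using orth[of k "(i, j)" k'] that by (auto simp: M split: if_splits)
  interpret partial_operation M by standard (rule fn)
  have Delta: "\<Delta> = cat_comult M"
    by (intro ext, unfold vec_eq_iff split_paired_All, subst linear_on_axes[OF linear_comult])
      (simp add: M cat_comult_def mult.commute)
  \<comment> \<open>The weak counit axiom at \<open>e\<^sub>i, e\<^sub>j, e\<^sub>k\<close>: the case \<open>i = j = k\<close> shows that \<open>\<epsilon> e\<^sub>i\<close> is \<open>0\<close> or \<open>1\<close>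
    and that \<open>ii = i\<close> if it is \<open>1\<close>; the case \<open>i \<noteq> k\<close> that distinct identities do not compose.\<close>
  have wc: "of_bool (i = j \<and> j = k) * \<epsilon> (axis i 1) = \<epsilon> (axis i 1) * \<epsilon> (axis k 1) * of_bool ((i, k, j) \<in> M)"
    for i j k
  proof -
    have "of_bool (i = j \<and> j = k) * \<epsilon> (axis i 1) = \<epsilon> (axis i 1 * axis j 1 * axis k 1)"
      by (auto simp: axis_mult E.scale E.zero)
    also have "\<dots> = (\<Sum>a\<in>UNIV. \<Sum>b\<in>UNIV. of_bool ((a, b, j) \<in> M) *
        (\<epsilon> (axis i 1 * axis a 1) * \<epsilon> (axis b 1 * axis k 1)))"
      by (simp add: weak_counit_left[of "axis i 1" "axis j 1" "axis k 1"] lift_tensor_scalar M)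
    also have "\<dots> = (\<Sum>a\<in>UNIV. \<Sum>b\<in>UNIV. of_bool (b = k) * (of_bool (a = i) *
        (\<epsilon> (axis i 1) * \<epsilon> (axis k 1) * of_bool ((a, b, j) \<in> M))))"
      by (intro sum.cong refl) (auto simp: axis_mult E.scale E.zero)
    also have "\<dots> = \<epsilon> (axis i 1) * \<epsilon> (axis k 1) * of_bool ((i, k, j) \<in> M)"
      by (simp only: sum_of_bool_mult)
    finally show ?thesis .
  qed
  have A: "\<epsilon> (axis i 1) = of_bool (i \<in> A)" for i
    using wc[of i i i] by (cases "(i, i, i) \<in> M") (auto simp: A_def)
  have eps: "\<epsilon> = cat_counit A"
    by (intro ext) (subst linear_functional_on_axes[OF linear_counit], simp add: cat_counit_def A mult.commute)
  have idem: "(u, u, u) \<in> M" if "u \<in> A" for u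
    using wc[of u u u] that by (auto simp: A split: if_splits)
  have ids: "u = v" if "u \<in> A" "v \<in> A" "(u, v, w) \<in> M" for u v w
    using wc[of u w v] that by (auto simp: A split: if_splits)
  have assoc: "(\<exists>p. (i, j, p) \<in> M \<and> (p, k, l) \<in> M) \<longleftrightarrow> (\<exists>q. (j, k, q) \<in> M \<and> (i, q, l) \<in> M)" for i j k l
  proof -
    have "tensor_assoc (tensor_map \<Delta> id (\<Delta> (axis l 1))) $ (i, j, k) = tensor_map id \<Delta> (\<Delta> (axis l 1)) $ (i, j, k)"
      by (simp add: coassoc)
    then show ?thesis
      unfolding Delta
      by (simp add: tensor_assoc_def cat_comult_left_iterate cat_comult_right_iterate
         axis_one_nth sum_of_bool_mult of_bool_eq_iff)
  qed
  have composable: "\<exists>l. (p, k, l) \<in> M" if "(i, j, p) \<in> M" "(j, k, q) \<in> M" for i j k p q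
  proof -
    have "\<Delta> 1 $ (i, j) * \<Delta> 1 $ (j, k) = tensor_map \<Delta> id (\<Delta> 1) $ ((i, j), k)"
      using arg_cong[OF weak_unit_left, of "\<lambda>t. t $ (i, j, k)"]
      by (simp only: weak_unit_pattern_nth) (simp add: tensor_assoc_def)
    then have "(of_bool (\<exists>p l. (i, j, p) \<in> M \<and> (p, k, l) \<in> M) :: 'k)
        = of_bool (\<exists>p. (i, j, p) \<in> M) * of_bool (\<exists>q. (j, k, q) \<in> M)"
      by (simp only: Delta cat_comult_one_left_iterate cat_comult_one)
    also have "\<dots> = of_bool True" using that by auto
    finally show ?thesis using that(1) fn unfolding of_bool_eq_iff by blast
  qed
  have left_unique: "u = v" if uv: "u \<in> A" "v \<in> A" and "(u, k, l) \<in> M" "(v, k, l) \<in> M" for u v k l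
  proof -
    have "(u, l, l) \<in> M" using assoc[of u u k l] idem that fn by blast
    moreover have "(v, l, l) \<in> M" using assoc[of v v k l] idem that fn by blast
    ultimately have "\<exists>p. (u, v, p) \<in> M" using assoc[of u v l l] by blast
    then show ?thesis using ids uv by blast
  qed
  have right_unique: "u = v" if uv: "u \<in> A" "v \<in> A" and "(k, u, l) \<in> M" "(k, v, l) \<in> M" for u v k l
  proof -
    have "(l, u, l) \<in> M" using assoc[of k u u l] idem that fn by blast
    moreover have "(l, v, l) \<in> M" using assoc[of k v v l] idem that fn by blast
    ultimately have "\<exists>p. (u, v, p) \<in> M" using assoc[of l u v l] by blast
    then show ?thesis using ids uv by blast
  qed
  \<comment> \<open>With at most one nonzero summand, the sum in the field decides existence in any characteristic.\<close>
  have one: "(\<exists>u. P u) \<longleftrightarrow> c" if "(\<Sum>u\<in>UNIV. of_bool (P u)) = (of_bool c :: 'k)" "\<And>u v. P u \<Longrightarrow> P v \<Longrightarrow> u = v"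
    for P :: "'n \<Rightarrow> bool" and c
  proof (cases "\<exists>u. P u")
    case True
    then obtain u where "P u" by blast
    then have "P v \<longleftrightarrow> v = u" for v using that(2) by blast
    with that(1) \<open>P u\<close> show ?thesis by (auto simp: of_bool_def split: if_splits)
  next
    case False
    then show ?thesis using that(1) by (auto split: if_splits)
  qed
  have left: "(\<exists>u. u \<in> A \<and> (u, k, l) \<in> M) \<longleftrightarrow> k = l" for k l
  proof (rule one)
    show "(\<Sum>u\<in>UNIV. of_bool (u \<in> A \<and> (u, k, l) \<in> M)) = (of_bool (k = l) :: 'k)"
      using arg_cong[OF counit_left[of "axis l 1"], of "\<lambda>x. x $ k"] unfolding eps
      by (simp add: cat_counit_left_contraction M axis_one_nth of_bool_conj)
  qed (use left_unique in blast)
  have right: "(\<exists>u. u \<in> A \<and> (k, u, l) \<in> M) \<longleftrightarrow> k = l" for k l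
  proof (rule one)
    show "(\<Sum>u\<in>UNIV. of_bool (u \<in> A \<and> (k, u, l) \<in> M)) = (of_bool (k = l) :: 'k)"
      using arg_cong[OF counit_right[of "axis l 1"], of "\<lambda>x. x $ k"] unfolding eps
      by (simp add: cat_counit_right_contraction M axis_one_nth of_bool_conj)
  qed (use right_unique in blast)
  have "arrow_category M A"
  proof (intro arrow_category.intro arrow_category_axioms.intro)
    show "\<exists>u\<in>A. (u, k, k) \<in> M" and "\<exists>u\<in>A. (k, u, k) \<in> M" for k
      using left[of k k] right[of k k] by blast+
    show "l = k" if "u \<in> A" "(u, k, l) \<in> M" for u k l using left[of k l] that by blast
    show "l = k" if "u \<in> A" "(k, u, l) \<in> M" for u k l using right[of k l] that by blast
  qed (fact partial_operation_axioms, fact assoc, fact composable)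
  then show ?thesis using that Delta eps by blast
qed

section \<open>The counital subalgebras\<close>

text \<open>
  Functions that factor through \<open>s\<close> are determined by their values on the range of \<open>s\<close>, and these
  values are arbitrary.
\<close>
lemma dim_range_reindex:
  fixes s :: "'n::finite \<Rightarrow> 'm::finite"
  shows "vec.dim (range (\<lambda>x :: 'k::field ^ 'm. \<chi> i. x $ s i)) = card (range s)"
proof -
  define \<phi> where "\<phi> = (\<lambda>x :: 'k ^ 'm. \<chi> i. x $ s i)"
  define U where "U = {x :: 'k ^ 'm. \<forall>i. i \<notin> range s \<longrightarrow> x $ i = 0}"
  have sub: "vec.span U = U"
    by (rule vec.span_unique) (auto simp: U_def vec.subspace_def)
  have lin: "Vector_Spaces.linear (*s) (*s) \<phi>"
    by (auto simp: \<phi>_def Vector_Spaces.linear_iff vec.vector_space_axioms vec_eq_iff)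
  have "inj_on \<phi> (vec.span U)"
    unfolding sub by (auto simp: inj_on_def \<phi>_def U_def vec_eq_iff) (metis rangeI image_iff)
  then have "vec.dim (\<phi> ` U) = vec.dim U" by (rule vec.dim_image_eq[OF lin])
  moreover have "range \<phi> = \<phi> ` U"
  proof
    show "range \<phi> \<subseteq> \<phi> ` U"
    proof clarify
      fix x
      have "\<phi> x = \<phi> (\<chi> i. of_bool (i \<in> range s) * x $ i)" by (simp add: \<phi>_def)
      then show "\<phi> x \<in> \<phi> ` U" by (rule image_eqI) (simp add: U_def)
    qed
  qed blast
  ultimately show ?thesis
    unfolding U_def dim_substandard_cart \<phi>_def by simp
qed

context arrow_category
begin

text \<open>
  If \<open>s l\<close> is the right identity of \<open>l\<close>, then \<open>\<epsilon>\<^sub>s(x) = x \<circ> s\<close>: in the contraction of \<open>\<Delta> 1\<close> only the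
  identity that composes with \<open>l\<close> survives. Since \<open>s\<close> fixes identities, its range is \<open>A\<close>.
  The target case is the same with left identities.
\<close>
lemma dim_source_subalgebra:
  "vec.dim (source_subalgebra (cat_comult M) (cat_counit A :: 'k::field ^ 'n \<Rightarrow> 'k)) = card A"
proof -
  have "\<forall>l. \<exists>u. u \<in> A \<and> (l, u, l) \<in> M" using right_identity_ex by blast
  from choice[OF this] obtain s where s: "s l \<in> A" "(l, s l, l) \<in> M" for l by blast
  have "lift_tensor (*s) (\<lambda>a b. cat_counit A (x * b) *s a) (cat_comult M 1) = (\<chi> l. x $ s l)"
    for x :: "'k ^ 'n"
  proof -
    have "of_bool (j \<in> A) * x $ j * cat_comult M 1 $ (l, j) = of_bool (j = s l) * x $ j" for j l
    proof (cases "j \<in> A \<and> j \<noteq> s l")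
      case True
      then have "\<nexists>k. (l, j, k) \<in> M" using right_identity_unique s by blast
      then show ?thesis using True by (simp add: cat_comult_one)
    next
      case False
      moreover have "\<exists>k. (l, s l, k) \<in> M" using s(2) by blast
      ultimately show ?thesis using s(1)[of l] by (cases "j = s l") (simp_all add: cat_comult_one)
    qed
    then show ?thesis
      by (simp only: vec_eq_iff source_contraction sum_of_bool_mult vec_lambda_beta simp_thms)
  qed
  then have "source_subalgebra (cat_comult M) (cat_counit A) = range (\<lambda>x :: 'k ^ 'n. \<chi> l. x $ s l)"
    by (simp add: source_subalgebra_def)
  moreover have "range s = A"
  proof -
    have "s u = u" if "u \<in> A" for u
      using right_identity_unique[OF that s(1) identity_idem[OF that] s(2)] by simp
    then show ?thesis using s(1) by (metis image_subsetI rangeI subsetI subset_antisym)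
  qed
  ultimately show ?thesis by (simp add: dim_range_reindex)
qed

lemma dim_target_subalgebra:
  "vec.dim (target_subalgebra (cat_comult M) (cat_counit A :: 'k::field ^ 'n \<Rightarrow> 'k)) = card A"
proof -
  have "\<forall>l. \<exists>u. u \<in> A \<and> (u, l, l) \<in> M" using left_identity_ex by blast
  from choice[OF this] obtain t where t: "t l \<in> A" "(t l, l, l) \<in> M" for l by blast
  have "lift_tensor (*s) (\<lambda>a b. cat_counit A (a * x) *s b) (cat_comult M 1) = (\<chi> l. x $ t l)"
    for x :: "'k ^ 'n"
  proof -
    have "of_bool (i \<in> A) * x $ i * cat_comult M 1 $ (i, l) = of_bool (i = t l) * x $ i" for i l
    proof (cases "i \<in> A \<and> i \<noteq> t l")
      case True
      then have "\<nexists>k. (i, l, k) \<in> M" using left_identity_unique t by blast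
      then show ?thesis using True by (simp add: cat_comult_one)
    next
      case False
      moreover have "\<exists>k. (t l, l, k) \<in> M" using t(2) by blast
      ultimately show ?thesis using t(1)[of l] by (cases "i = t l") (simp_all add: cat_comult_one)
    qed
    then show ?thesis
      by (simp only: vec_eq_iff target_contraction sum_of_bool_mult vec_lambda_beta simp_thms)
  qed
  then have "target_subalgebra (cat_comult M) (cat_counit A) = range (\<lambda>x :: 'k ^ 'n. \<chi> l. x $ t l)"
    by (simp add: target_subalgebra_def)
  moreover have "range t = A"
  proof -
    have "t u = u" if "u \<in> A" for u
      using left_identity_unique[OF that t(1) identity_idem[OF that] t(2)] by simp
    then show ?thesis using t(1) by (metis image_subsetI rangeI subsetI subset_antisym)
  qed
  ultimately show ?thesis by (simp add: dim_range_reindex)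
qed

lemma one_object_composable: "A = {u} \<Longrightarrow> \<exists>k. (i, j, k) \<in> M"
  using right_identity_ex[of i] left_identity_ex[of j] composable by blast

text \<open>
  With one object all arrows compose, so \<open>\<Delta> 1\<close> is \<open>1\<close> in every coordinate, and the counit is
  evaluation at the only identity.
\<close>
lemma bialgebra_of_one_object:
  assumes "A = {u}"
  shows "bialgebra (cat_comult M) (cat_counit A :: 'k::field ^ 'n \<Rightarrow> 'k)"
proof -
  have eps: "cat_counit A x = x $ u" for x :: "'k ^ 'n"
    by (simp add: cat_counit_def assms sum_of_bool_mult)
  show ?thesis
    by (intro bialgebra.intro weak_bialgebra_of_category bialgebra_axioms.intro)
      (simp_all add: eps vec_eq_iff tensor_one cat_comult_one one_object_composable[OF assms])
qed

lemma group_like_of_identity: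
  assumes "u \<in> A" and "\<And>i j. (i, j, u) \<in> M \<Longrightarrow> i = u \<and> j = u"
  shows "group_like (cat_comult M) (cat_counit A) (axis u (1 :: 'k::field))"
proof -
  have "(i, j, u) \<in> M \<longleftrightarrow> i = u \<and> j = u" for i j using assms identity_idem by blast
  then have "cat_comult M (axis u (1 :: 'k)) = axis u 1 \<otimes> axis u 1"
    by (auto simp: vec_eq_iff cat_comult_axis tensor_def axis_one_nth)
  then show ?thesis by (simp add: group_like_def cat_counit_axis assms)
qed

lemma discrete_composition:
  assumes "A = UNIV"
  shows "(i, j, k) \<in> M \<longleftrightarrow> i = k \<and> j = k"
  using identity_idem left_identity right_identity assms by blast

end

section \<open>Isomorphisms\<close>

text \<open>
  Every coordinate of \<open>f\<close> is a unital algebra morphism \<open>k\<^sup>n \<rightarrow> k\<close>. It maps the basis vectors to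
  orthogonal idempotents of the field with sum \<open>1\<close>, so it picks out exactly one of them and is an
  evaluation.
\<close>
lemma pointwise_automorphism_is_reindexing:
  fixes f :: "'k::field ^ 'n::finite \<Rightarrow> 'k ^ 'n"
  assumes lin: "Vector_Spaces.linear (*s) (*s) f" and "bij f"
    and mult: "\<And>x y. f (x * y) = f x * f y" and one: "f 1 = 1"
  obtains \<tau> where "bij \<tau>" "\<And>x j. f x $ j = x $ \<tau> j"
proof -
  interpret Vector_Spaces.linear "(*s)" "(*s)" f by (rule lin)
  have "\<exists>i. \<forall>x. f x $ j = x $ i" for j
  proof -
    have "(\<Sum>i\<in>UNIV. f (axis i 1) $ j) = 1" using linear_on_axes[OF lin, of 1 j] one by simp
    then obtain i where i: "f (axis i 1) $ j \<noteq> 0" by (metis sum.neutral zero_neq_one)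
    have "f (axis i 1) $ j * f (axis k 1) $ j = of_bool (k = i) * f (axis i 1) $ j" for k
    proof -
      have "axis i 1 * axis k 1 = (of_bool (k = i) *s axis i 1 :: 'k ^ 'n)"
        by (auto simp: vec_eq_iff axis_def)
      then have "f (axis i 1) * f (axis k 1) = of_bool (k = i) *s f (axis i 1)"
        by (simp only: scale flip: mult)
      then show ?thesis by (simp only: vec_eq_iff vector_mult_component vector_smult_component)
    qed
    then have "f (axis k 1) $ j = of_bool (k = i)" for k
      using i by (metis mult.commute mult_cancel_left)
    then have "f x $ j = x $ i" for x
      by (subst linear_on_axes[OF lin]) (simp add: sum_of_bool_mult)
    then show ?thesis by blast
  qed
  then obtain \<tau> where \<tau>: "f x $ j = x $ \<tau> j" for x j by metis
  have "i \<in> range \<tau>" for i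
  proof (rule ccontr)
    assume "i \<notin> range \<tau>"
    then have "f (axis i 1) = f 0" by (auto simp: vec_eq_iff \<tau> axis_def)
    then have "axis i 1 = (0 :: 'k ^ 'n)" by (rule injD[OF bij_is_inj[OF \<open>bij f\<close>]])
    then show False by (simp add: vec_eq_iff axis_one_nth)
  qed
  then have "surj \<tau>" by blast
  then have "bij \<tau>" using finite_UNIV_surj_inj[of \<tau>] by (simp add: bij_def)
  then show ?thesis using that \<tau> by blast
qed

definition relabel :: "('m \<Rightarrow> 'n) \<Rightarrow> ('m \<times> 'm \<times> 'm) set \<Rightarrow> ('n \<times> 'n \<times> 'n) set"
  where "relabel \<tau> M = (\<lambda>(i, j, k). (\<tau> i, \<tau> j, \<tau> k)) ` M"

lemma mem_relabel: "inj \<tau> \<Longrightarrow> (\<tau> i, \<tau> j, \<tau> k) \<in> relabel \<tau> M \<longleftrightarrow> (i, j, k) \<in> M"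
  by (auto simp: relabel_def inj_eq intro: image_eqI[where x = "(i, j, k)"])

lemma relabel_eqI:
  assumes "bij \<tau>" "\<And>i j k. (i, j, k) \<in> M' \<longleftrightarrow> (\<tau> i, \<tau> j, \<tau> k) \<in> M"
  shows "M = relabel \<tau> M'"
proof -
  have "(i, j, k) \<in> M \<longleftrightarrow> (i, j, k) \<in> relabel \<tau> M'" for i j k
    using assms mem_relabel[of \<tau> "inv \<tau> i" "inv \<tau> j" "inv \<tau> k" M']
    by (simp add: bij_is_inj bij_is_surj surj_f_inv_f)
  then show ?thesis by auto
qed

text \<open>
  Functions pull back: the automorphism attached to \<open>\<tau>\<close> is composition with \<open>\<tau>\<close>. This is why an
  isomorphism from the structure of \<open>(M, A)\<close> to that of \<open>(M', A')\<close> relabels \<open>M'\<close> to \<open>M\<close>.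
\<close>
theorem cat_structs_isomorphic_iff:
  fixes M M' :: "('n::finite \<times> 'n \<times> 'n) set"
  shows "(cat_comult M, cat_counit A :: 'k::field ^ 'n \<Rightarrow> 'k) \<cong>\<^sub>w\<^sub>b (cat_comult M', cat_counit A') \<longleftrightarrow>
    (\<exists>\<tau>. bij \<tau> \<and> M = relabel \<tau> M' \<and> A = \<tau> ` A')"
    (is "?iso \<longleftrightarrow> ?cat")
proof
  assume ?iso
  then obtain f :: "'k ^ 'n \<Rightarrow> 'k ^ 'n" where f: "Vector_Spaces.linear (*s) (*s) f" "bij f"
      "\<And>x y. f (x * y) = f x * f y" "f 1 = 1"
    and com: "\<And>x. cat_comult M' (f x) = tensor_map f f (cat_comult M x)"
    and cou: "\<And>x. cat_counit A' (f x) = cat_counit A x"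
    unfolding wb_isomorphic_def by auto
  obtain \<tau> where \<tau>: "bij \<tau>" "\<And>x j. f x $ j = x $ \<tau> j"
    using pointwise_automorphism_is_reindexing[OF f] by metis
  have ax: "f (axis (\<tau> k) 1) = axis k 1" for k
    using \<tau>(1) by (auto simp: vec_eq_iff \<tau>(2) axis_one_nth bij_def inj_eq)
  have "(i, j, k) \<in> M' \<longleftrightarrow> (\<tau> i, \<tau> j, \<tau> k) \<in> M" for i j k
    using arg_cong[OF com[of "axis (\<tau> k) 1"], of "\<lambda>t. t $ (i, j)"]
    by (simp add: ax cat_comult_axis tensor_map_nth \<tau>(2) axis_one_nth sum_of_bool_mult of_bool_eq_iff
        flip: mult.assoc)
  then have "M = relabel \<tau> M'" by (intro relabel_eqI \<tau>(1))
  moreover have "i \<in> A' \<longleftrightarrow> \<tau> i \<in> A" for i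
    using cou[of "axis (\<tau> i) 1"] by (simp add: ax cat_counit_axis of_bool_eq_iff)
  then have "A = \<tau> ` A'" using \<tau>(1) by (auto simp: bij_def) (metis rangeI image_iff)
  ultimately show ?cat using \<tau>(1) by blast
next
  assume ?cat
  then obtain \<tau> where \<tau>: "bij \<tau>" "M = relabel \<tau> M'" "A = \<tau> ` A'" by blast
  define f where "f = (\<lambda>x :: 'k ^ 'n. \<chi> j. x $ \<tau> j)"
  have "Vector_Spaces.linear (*s) (*s) f"
    by (auto simp: f_def Vector_Spaces.linear_iff vec.vector_space_axioms vec_eq_iff)
  moreover have "bij f"
    using \<tau>(1) by (intro o_bij[of "\<lambda>x. \<chi> j. x $ inv \<tau> j"])
      (auto simp: f_def fun_eq_iff vec_eq_iff bij_def surj_f_inv_f)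
  moreover have "cat_comult M' (f x) = tensor_map f f (cat_comult M x)" for x
  proof -
    have "tensor_map f f (cat_comult M x) $ (i, j) = cat_comult M x $ (\<tau> i, \<tau> j)" for i j
      by (simp add: tensor_map_nth f_def axis_one_nth sum_of_bool_mult flip: mult.assoc)
    moreover have "cat_comult M x $ (\<tau> i, \<tau> j) = cat_comult M' (f x) $ (i, j)" for i j
    proof -
      have "cat_comult M x $ (\<tau> i, \<tau> j) = (\<Sum>k\<in>UNIV. of_bool ((\<tau> i, \<tau> j, \<tau> k) \<in> M) * x $ \<tau> k)"
        using sum.reindex_bij_betw[OF \<tau>(1), of "\<lambda>k. of_bool ((\<tau> i, \<tau> j, k) \<in> M) * x $ k"]
        by (simp add: cat_comult_def)
      then show ?thesis using \<tau>(1) by (simp add: \<tau>(2) mem_relabel bij_is_inj f_def cat_comult_def)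
    qed
    ultimately show ?thesis by (simp add: vec_eq_iff)
  qed
  moreover have "cat_counit A' (f x) = cat_counit A x" for x
  proof -
    have "cat_counit A x = (\<Sum>k\<in>UNIV. of_bool (\<tau> k \<in> A) * x $ \<tau> k)"
      using sum.reindex_bij_betw[OF \<tau>(1), of "\<lambda>k. of_bool (k \<in> A) * x $ k"]
      by (simp add: cat_counit_def)
    then show ?thesis using \<tau>(1) by (simp add: \<tau>(3) bij_is_inj inj_image_mem_iff f_def cat_counit_def)
  qed
  ultimately show ?iso
    unfolding wb_isomorphic_def by (auto intro!: exI[of _ f] simp: f_def vec_eq_iff)
qed

lemma relabel_id: "relabel id M = M"
  by (auto simp: relabel_def)

lemma relabel_comp: "relabel \<sigma> (relabel \<tau> M) = relabel (\<sigma> \<circ> \<tau>) M"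
  by (force simp: relabel_def)

lemma wb_structures_eq:
  "(S :: ('k::field, 'n::finite) wb_struct) \<in> wb_structures \<longleftrightarrow>
    (\<exists>M A. arrow_category M A \<and> S = (cat_comult M, cat_counit A))"
proof
  assume "S \<in> wb_structures"
  then have "weak_bialgebra (fst S) (snd S)" by (auto simp: wb_structures_def)
  then obtain M A where "arrow_category M A" "fst S = cat_comult M" "snd S = cat_counit A"
    by (rule category_of_weak_bialgebra)
  then show "\<exists>M A. arrow_category M A \<and> S = (cat_comult M, cat_counit A)"
    by (metis prod.collapse)
qed (auto simp: wb_structures_def intro: arrow_category.weak_bialgebra_of_category)

lemma equiv_wb_iso_rel: "equiv wb_structures (wb_iso_rel :: (('k::field, 'n::finite) wb_struct \<times> _) set)"
proof (rule equivI)
  show "(wb_iso_rel :: (('k, 'n) wb_struct \<times> _) set) \<subseteq> wb_structures \<times> wb_structures"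
    by (auto simp: wb_iso_rel_def)
  show "refl_on wb_structures (wb_iso_rel :: (('k, 'n) wb_struct \<times> _) set)"
    unfolding refl_on_def wb_iso_rel_def
    by (auto simp: wb_structures_eq cat_structs_isomorphic_iff intro!: exI[of _ id] simp: relabel_id)
  show "sym (wb_iso_rel :: (('k, 'n) wb_struct \<times> _) set)"
  proof (rule symI)
    fix S T :: "('k, 'n) wb_struct"
    assume ST: "(S, T) \<in> wb_iso_rel"
    then obtain M A M' A' where eqs: "S = (cat_comult M, cat_counit A)" "T = (cat_comult M', cat_counit A')"
      unfolding wb_iso_rel_def wb_structures_eq by auto
    with ST obtain \<tau> where "bij \<tau>" "M = relabel \<tau> M'" "A = \<tau> ` A'"
      by (auto simp: wb_iso_rel_def cat_structs_isomorphic_iff)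
    then have "bij (inv \<tau>)" "M' = relabel (inv \<tau>) M" "A' = inv \<tau> ` A"
      by (simp_all add: bij_imp_bij_inv relabel_comp bij_is_inj relabel_id image_comp)
    then show "(T, S) \<in> wb_iso_rel"
      using ST by (auto simp: wb_iso_rel_def eqs cat_structs_isomorphic_iff)
  qed
  show "trans (wb_iso_rel :: (('k, 'n) wb_struct \<times> _) set)"
  proof (rule transI)
    fix S T U :: "('k, 'n) wb_struct"
    assume ST: "(S, T) \<in> wb_iso_rel" and TU: "(T, U) \<in> wb_iso_rel"
    then obtain M A M' A' M'' A'' where eqs: "S = (cat_comult M, cat_counit A)"
        "T = (cat_comult M', cat_counit A')" "U = (cat_comult M'', cat_counit A'')"
      unfolding wb_iso_rel_def wb_structures_eq by auto
    from ST obtain \<sigma> where \<sigma>: "bij \<sigma>" "M = relabel \<sigma> M'" "A = \<sigma> ` A'"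
      by (auto simp: wb_iso_rel_def eqs cat_structs_isomorphic_iff)
    from TU obtain \<tau> where \<tau>: "bij \<tau>" "M' = relabel \<tau> M''" "A' = \<tau> ` A''"
      by (auto simp: wb_iso_rel_def eqs cat_structs_isomorphic_iff)
    have "bij (\<sigma> \<circ> \<tau>)" "M = relabel (\<sigma> \<circ> \<tau>) M''" "A = (\<sigma> \<circ> \<tau>) ` A''"
      using \<sigma> \<tau> by (auto simp: bij_comp relabel_comp)
    then have "S \<cong>\<^sub>w\<^sub>b U" unfolding eqs cat_structs_isomorphic_iff by blast
    then show "(S, U) \<in> wb_iso_rel" using ST TU by (simp add: wb_iso_rel_def)
  qed
qed

lemma card_quotient_representatives:
  assumes "equiv S r" "R \<subseteq> S" "\<And>x. x \<in> S \<Longrightarrow> \<exists>y\<in>R. (x, y) \<in> r"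
    and "\<And>x y. x \<in> R \<Longrightarrow> y \<in> R \<Longrightarrow> (x, y) \<in> r \<Longrightarrow> x = y"
  shows "card (S // r) = card R"
proof -
  have "bij_betw (\<lambda>x. r `` {x}) R (S // r)"
    unfolding bij_betw_def
  proof
    show "inj_on (\<lambda>x. r `` {x}) R"
      using assms by (intro inj_onI) (metis eq_equiv_class subsetD)
    show "(\<lambda>x. r `` {x}) ` R = S // r"
    proof
      show "(\<lambda>x. r `` {x}) ` R \<subseteq> S // r" using assms(2) by (auto intro: quotientI)
      show "S // r \<subseteq> (\<lambda>x. r `` {x}) ` R"
        using assms(1,3) by (auto elim!: quotientE) (metis equiv_class_eq image_eqI)
    qed
  qed
  then show ?thesis by (simp add: bij_betw_same_card)
qed

section \<open>Categories with three arrows\<close>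

text \<open>
  The four-tuple lists the products \<open>bb, bc, cb, cc\<close>; the element \<open>a\<close> is the unit.
\<close>
definition monoid_table :: "'n \<Rightarrow> 'n \<Rightarrow> 'n \<Rightarrow> 'n \<times> 'n \<times> 'n \<times> 'n \<Rightarrow> ('n \<times> 'n \<times> 'n) set"
  where "monoid_table a b c = (\<lambda>(p, q, r, s).
    {(a, a, a), (a, b, b), (b, a, b), (a, c, c), (c, a, c), (b, b, p), (b, c, q), (c, b, r), (c, c, s)})"

text \<open>
  In this order: the cyclic group; the group of order two with a zero \<open>c\<close>; left zeros, right
  zeros, a two-element chain, a null semigroup with zero \<open>b\<close>, and the group of order two with
  identity \<open>b\<close>, each with a new unit \<open>a\<close>.
\<close>
definition one_object_tables :: "'n \<Rightarrow> 'n \<Rightarrow> 'n \<Rightarrow> ('n \<times> 'n \<times> 'n) set list"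
  where "one_object_tables a b c = map (monoid_table a b c)
    [(c, a, a, b), (a, c, c, c), (b, b, c, c), (b, c, b, c), (b, b, b, c), (b, b, b, b), (b, c, c, b)]"

text \<open>
  The arrow \<open>c\<close> joins the two objects, is an idempotent loop at \<open>a\<close>, or is an involution at \<open>a\<close>.
\<close>
definition two_object_tables :: "'n \<Rightarrow> 'n \<Rightarrow> 'n \<Rightarrow> ('n \<times> 'n \<times> 'n) set list"
  where "two_object_tables a b c = map ((\<union>) {(a, a, a), (b, b, b)})
    [{(b, c, c), (c, a, c)}, {(a, c, c), (c, a, c), (c, c, c)}, {(a, c, c), (c, a, c), (c, c, a)}]"

definition discrete_table :: "'n \<Rightarrow> 'n \<Rightarrow> 'n \<Rightarrow> ('n \<times> 'n \<times> 'n) set"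
  where "discrete_table a b c = {(a, a, a), (b, b, b), (c, c, c)}"

definition three_arrow_categories :: "'n \<Rightarrow> 'n \<Rightarrow> 'n \<Rightarrow> (('n \<times> 'n \<times> 'n) set \<times> 'n set) list"
  where "three_arrow_categories a b c = map (\<lambda>M. (M, {a})) (one_object_tables a b c) @
    map (\<lambda>M. (M, {a, b})) (two_object_tables a b c) @ [(discrete_table a b c, {a, b, c})]"

lemmas three_arrow_defs = three_arrow_categories_def one_object_tables_def two_object_tables_def
  discrete_table_def monoid_table_def

context arrow_category
begin

text \<open>
  With the unit laws, a monoid on \<open>{a, b, c}\<close> is given by four products. Of the 81 choices,
  associativity on triples from \<open>{b, c}\<close> leaves eleven. Exchanging \<open>b\<close> and \<open>c\<close> fixes three of
  them (cyclic, left zero, right zero) and pairs the other eight, which leaves seven up to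
  relabelling.
\<close>
lemma one_object_three_arrows:
  assumes A: "A = {a}" and abc: "distinct [a, b, c]" "UNIV = {a, b, c}"
  shows "M \<in> set (one_object_tables a b c) \<union> set (one_object_tables a c b)"
proof -
  define m where "m i j = (SOME k. (i, j, k) \<in> M)" for i j
  have m: "(i, j, m i j) \<in> M" for i j
    unfolding m_def by (rule someI_ex[OF one_object_composable[OF A]])
  have iff: "(i, j, k) \<in> M \<longleftrightarrow> k = m i j" for i j k
    using m composite_unique by blast
  have unit: "m a x = x" "m x a = x" for x
    using left_identity[of a x] right_identity[of a x] m A by auto
  have "m (m i j) k = m i (m j k)" for i j k
    using assoc[of i j k "m (m i j) k"] by (simp add: iff)
  note this[of b b b] this[of b b c] this[of b c b] this[of b c c]
    this[of c b b] this[of c b c] this[of c c b] this[of c c c]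
  moreover have "m x y = a \<or> m x y = b \<or> m x y = c" for x y
    using abc(2) by blast
  note this[of b b] this[of b c] this[of c b] this[of c c]
  ultimately have table: "(m b b, m b c, m c b, m c c) \<in> set [(c, a, a, b), (a, c, c, c), (b, b, c, c),
      (b, c, b, c), (b, b, b, c), (b, b, b, b), (b, c, c, b), (b, b, b, a), (c, c, c, c), (b, c, c, c), (c, b, b, c)]"
    using abc(1) by (elim disjE) (simp_all add: unit)
  have M_eq: "M = monoid_table a b c (m b b, m b c, m c b, m c c)"
  proof -
    have "M = {(i, j, m i j) |i j. True}" using iff by auto
    also have "\<dots> = (\<lambda>(i, j). (i, j, m i j)) ` ({a, b, c} \<times> {a, b, c})"
      unfolding abc(2)[symmetric] by auto
    also have "\<dots> = monoid_table a b c (m b b, m b c, m c b, m c c)"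
      unfolding monoid_table_def by (simp add: unit insert_commute)
    finally show ?thesis .
  qed
  have swap: "monoid_table a c b = (\<lambda>(p, q, r, s). monoid_table a b c (s, r, q, p))"
    by (auto simp: monoid_table_def fun_eq_iff)
  have "monoid_table a b c P \<in> set (one_object_tables a b c) \<union> set (one_object_tables a c b)"
    if "P \<in> set [(c, a, a, b), (a, c, c, c), (b, b, c, c), (b, c, b, c),
      (b, b, b, c), (b, b, b, b), (b, c, c, b), (b, b, b, a), (c, c, c, c), (b, c, c, c), (c, b, b, c)]" for P
    using that unfolding list.set insert_iff empty_iff
    by (elim disjE FalseE; simp add: one_object_tables_def swap)
  from this[OF table] show ?thesis using M_eq by simp
qed

text \<open>
  Let \<open>s\<close> and \<open>t\<close> be the left and right identity of the third arrow \<open>c\<close>. If \<open>s \<noteq> t\<close> then \<open>c\<close> does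
  not compose with itself. If \<open>s = t\<close> then \<open>cc\<close> exists and is a loop at the same object, so it is
  \<open>c\<close> or \<open>s\<close>. All composites with identities are forced.
\<close>
lemma two_objects_three_arrows:
  assumes A: "A = {a, b}" and abc: "distinct [a, b, c]" "UNIV = {a, b, c}"
  shows "M \<in> set (two_object_tables a b c) \<union> set (two_object_tables b a c)"
proof -
  obtain s where s: "s \<in> A" "(s, c, c) \<in> M" using left_identity_ex[of c] by blast
  obtain t where t: "t \<in> A" "(c, t, c) \<in> M" using right_identity_ex[of c] by blast
  have ids: "(u, w, k) \<in> M \<longleftrightarrow> u = w \<and> k = u" if "u \<in> A" "w \<in> A" for u w k
    using that identity_idem[of u] identities_composable_eq[of u w k] left_identity[of u w k] by auto
  have left: "(u, c, k) \<in> M \<longleftrightarrow> u = s \<and> k = c" if "u \<in> A" for u k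
    using s left_identity_unique[OF that s(1), of c k c] left_identity[OF that, of c k] by blast
  have right: "(c, u, k) \<in> M \<longleftrightarrow> u = t \<and> k = c" if "u \<in> A" for u k
    using t right_identity_unique[OF that t(1), of c k c] right_identity[OF that, of c k] by blast
  \<comment> \<open>\<open>X\<close> collects the only composite that the unit laws leave open.\<close>
  define X where "X = {(c, c, k) |k. (c, c, k) \<in> M}"
  have M_eq: "M = {(a, a, a), (b, b, b), (s, c, c), (c, t, c)} \<union> X"
  proof -
    have key: "(i, j, k) \<in> M \<longleftrightarrow> (i, j, k) \<in> {(a, a, a), (b, b, b), (s, c, c), (c, t, c)} \<union> X"
      for i j k
    proof -
      have "i = a \<or> i = b \<or> i = c" "j = a \<or> j = b \<or> j = c" using abc(2) by blast+
      then show ?thesis using abc(1) A s(1) t(1) by (elim disjE) (auto simp: X_def ids left right)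
    qed
    show ?thesis unfolding set_eq_iff split_paired_All by (intro allI) (rule key)
  qed
  show ?thesis
  proof (cases "s = t")
    case True
    have "(c, c, k) \<notin> M" if k: "k \<in> A" "k \<noteq> s" for k
    proof
      assume "(c, c, k) \<in> M"
      then have "\<exists>q. (c, k, q) \<in> M" using assoc[of c c k k] identity_idem[OF k(1)] by blast
      then show False using right[OF k(1)] k(2) True by blast
    qed
    moreover obtain x where x: "(c, c, x) \<in> M" using composable[OF t(2)] s(2) True by blast
    ultimately have "x = s \<or> x = c" using A abc(2) by blast
    moreover have "X = {(c, c, x)}" unfolding X_def using x composite_unique by auto
    moreover have "s = a \<or> s = b" using A s(1) by blast
    ultimately have "M = {(a, a, a), (b, b, b), (s, c, c), (c, s, c), (c, c, x)}"
        "x = s \<or> x = c" "s = a \<or> s = b"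
      using M_eq True by (simp_all add: insert_commute)
    then show ?thesis by (elim disjE) (simp_all add: two_object_tables_def insert_commute)
  next
    case False
    have "(c, c, x) \<notin> M" for x
    proof
      assume "(c, c, x) \<in> M"
      then have "\<exists>q. (t, c, q) \<in> M" using assoc[of c t c x] t(2) by blast
      then show False using left[OF t(1)] False by blast
    qed
    then have "X = {}" by (simp add: X_def)
    with M_eq have "M = {(a, a, a), (b, b, b), (s, c, c), (c, t, c)}" by simp
    moreover have "s = a \<and> t = b \<or> s = b \<and> t = a" using A s(1) t(1) False by blast
    ultimately show ?thesis
      by (elim disjE conjE) (simp_all add: two_object_tables_def insert_commute)
  qed
qed

lemma discrete_three_arrows:
  assumes A: "A = UNIV" and abc: "UNIV = {a, b, c}"
  shows "M = discrete_table a b c"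
proof -
  have "M = {(i, i, i) |i. i \<in> UNIV}"
    using discrete_composition[OF A] by auto
  then show ?thesis unfolding abc by (auto simp: discrete_table_def)
qed

end

lemma one_object_tables_relabel:
  "one_object_tables (\<tau> a) (\<tau> b) (\<tau> c) = map (relabel \<tau>) (one_object_tables a b c)"
  by (simp add: three_arrow_defs relabel_def)

lemma two_object_tables_relabel:
  "two_object_tables (\<tau> a) (\<tau> b) (\<tau> c) = map (relabel \<tau>) (two_object_tables a b c)"
  by (simp add: three_arrow_defs relabel_def)

lemma discrete_table_relabel: "discrete_table (\<tau> a) (\<tau> b) (\<tau> c) = relabel \<tau> (discrete_table a b c)"
  by (simp add: three_arrow_defs relabel_def)

lemma distinct_3: "(1::3) \<noteq> 2" "(1::3) \<noteq> 3" "(2::3) \<noteq> 3" "(2::3) \<noteq> 1" "(3::3) \<noteq> 1" "(3::3) \<noteq> 2"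
  by simp_all

lemma third_element:
  fixes a b :: 3
  assumes "a \<noteq> b"
  obtains c where "distinct [a, b, c]" "UNIV = {a, b, c}"
proof -
  obtain c where "c \<in> UNIV - {a, b}"
  proof -
    have "card (UNIV - {a, b}) = 1" using assms by (simp add: card_Diff_subset)
    then show ?thesis using that by (metis card_1_singletonE insertI1)
  qed
  then have "distinct [a, b, c]" using assms by auto
  moreover from this have "card {a, b, c} = CARD(3)" by simp
  then have "{a, b, c} = UNIV" by (intro card_eq_UNIV_imp_eq_UNIV) simp_all
  ultimately show ?thesis using that by blast
qed

text \<open>
  The one- and two-object cases yield a table only up to exchanging two arrows. The exchange is
  absorbed by the choice of names \<open>a, b, c\<close>.
\<close>
theorem three_arrow_classification:
  fixes M :: "(3 \<times> 3 \<times> 3) set"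
  assumes "arrow_category M A"
  obtains a b c where "distinct [a, b, c]" "UNIV = {a, b, c}"
    "A = {a} \<and> M \<in> set (one_object_tables a b c) \<or>
     A = {a, b} \<and> M \<in> set (two_object_tables a b c) \<or>
     A = {a, b, c} \<and> M = discrete_table a b c"
proof -
  interpret arrow_category M A by (rule assms)
  have "card A \<le> 3" using card_mono[of UNIV A] by simp
  moreover have "A \<noteq> {}" using left_identity_ex by blast
  then have "card A \<noteq> 0" by simp
  ultimately consider "card A = 1" | "card A = 2" | "card A = 3" by linarith
  then show ?thesis
  proof cases
    case 1
    then obtain a where A: "A = {a}" by (rule card_1_singletonE)
    have "\<exists>b. a \<noteq> b" using distinct_3 by metis
    then obtain b c where abc: "distinct [a, b, c]" "UNIV = {a, b, c}" by (metis third_element)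
    show ?thesis
      using one_object_three_arrows[OF A abc] that[OF abc] that[of a c b] abc A
      by (auto simp: insert_commute)
  next
    case 2
    then obtain a b where A: "A = {a, b}" "a \<noteq> b" by (auto simp: card_2_iff)
    then obtain c where abc: "distinct [a, b, c]" "UNIV = {a, b, c}" by (metis third_element)
    show ?thesis
      using two_objects_three_arrows[OF A(1) abc] that[OF abc] that[of b a c] abc A
      by (auto simp: insert_commute)
  next
    case 3
    then have A: "A = UNIV" by (intro card_eq_UNIV_imp_eq_UNIV) simp_all
    obtain c where abc: "distinct [1, 2, c]" "(UNIV :: 3 set) = {1, 2, c}"
      using third_element distinct_3(1) by metis
    show ?thesis using that[OF abc] discrete_three_arrows[OF A abc(2)] A abc(2) by simp
  qed
qed

lemma reindexing_exists:
  fixes a b c :: 3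
  assumes "distinct [a, b, c]"
  obtains \<tau> :: "3 \<Rightarrow> 3" where "bij \<tau>" "\<tau> 1 = a" "\<tau> 2 = b" "\<tau> 3 = c"
proof -
  define \<tau> where "\<tau> x = (if x = 1 then a else if x = 2 then b else c)" for x :: 3
  have "inj \<tau>"
    unfolding inj_def forall_3 using assms by (auto simp: \<tau>_def)
  then have "bij \<tau>" using finite_UNIV_inj_surj[of \<tau>] by (simp add: bij_def)
  then show ?thesis using that by (simp add: \<tau>_def)
qed

section \<open>The eleven structures\<close>

lemma function_structures_one_object:
  "map (\<lambda>M. (cat_comult M, cat_counit {1})) (one_object_tables 1 2 3) = [B1, B2, B3, B4, B5, B6, B7]"
  by (simp add: three_arrow_defs B1_def B2_def B3_def B4_def B5_def B6_def B7_def fun_eq_iff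
    vec_eq_iff forall_3 tensor_def axis_one_nth cat_comult_def cat_counit_def sum_3)

lemma function_structures_two_objects:
  "map (\<lambda>M. (cat_comult M, cat_counit {1, 2})) (two_object_tables 1 2 3) = [W2a, W2b, W2c]"
  by (simp add: three_arrow_defs W2a_def W2b_def W2c_def fun_eq_iff
    vec_eq_iff forall_3 tensor_def axis_one_nth cat_comult_def cat_counit_def sum_3)

lemma function_structure_discrete:
  "(cat_comult (discrete_table 1 2 3), cat_counit {1, 2, 3}) = W3"
  by (simp add: three_arrow_defs W3_def fun_eq_iff
    vec_eq_iff forall_3 tensor_def axis_one_nth cat_comult_def cat_counit_def sum_3)

abbreviation three_arrow_structures :: "('k::field, 3) wb_struct list"
  where "three_arrow_structures \<equiv>
    map (\<lambda>(M, A). (cat_comult M, cat_counit A)) (three_arrow_categories 1 2 3)"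

lemma three_arrow_structures_eq:
  "three_arrow_structures = [B1, B2, B3, B4, B5, B6, B7, W2a, W2b, W2c, W3]"
  by (simp add: three_arrow_categories_def comp_def function_structures_one_object
      function_structures_two_objects function_structure_discrete)

text \<open>
  Relabelling by a permutation that sends \<open>1, 2, 3\<close> to \<open>a, b, c\<close> turns the standard table into the
  given one, and relabelled tables have isomorphic function algebras.
\<close>
lemma three_arrow_structure_cases:
  assumes cat: "arrow_category M (A :: 3 set)"
  obtains (one) a S where "A = {a}" "S \<in> {B1, B2, B3, B4, B5, B6, B7}"
      "(cat_comult M, cat_counit A :: 'k::field ^ 3 \<Rightarrow> 'k) \<cong>\<^sub>w\<^sub>b S"
  | (two) a b S where "A = {a, b}" "a \<noteq> b" "S \<in> {W2a, W2b, W2c}"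
      "(cat_comult M, cat_counit A :: 'k::field ^ 3 \<Rightarrow> 'k) \<cong>\<^sub>w\<^sub>b S"
  | (three) "A = UNIV" "(cat_comult M, cat_counit A :: 'k::field ^ 3 \<Rightarrow> 'k) \<cong>\<^sub>w\<^sub>b W3"
proof -
  obtain a b c where abc: "distinct [a, b, c]" "UNIV = {a, b, c}" and
    cases: "A = {a} \<and> M \<in> set (one_object_tables a b c) \<or>
      A = {a, b} \<and> M \<in> set (two_object_tables a b c) \<or>
      A = {a, b, c} \<and> M = discrete_table a b c"
    by (rule three_arrow_classification[OF cat])
  obtain \<tau> :: "3 \<Rightarrow> 3" where \<tau>: "bij \<tau>" "\<tau> 1 = a" "\<tau> 2 = b" "\<tau> 3 = c"
    by (rule reindexing_exists[OF abc(1)])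
  have iso: "(cat_comult M, cat_counit A :: 'k ^ 3 \<Rightarrow> 'k) \<cong>\<^sub>w\<^sub>b (cat_comult M', cat_counit A')"
    if "M = relabel \<tau> M'" "A = \<tau> ` A'" for M' A'
    unfolding cat_structs_isomorphic_iff using that \<tau>(1) by blast
  from cases consider
      "A = {a}" "M \<in> set (one_object_tables a b c)"
    | "A = {a, b}" "M \<in> set (two_object_tables a b c)"
    | "A = {a, b, c}" "M = discrete_table a b c" by blast
  then show ?thesis
  proof cases
    case 1
    then obtain M' where M': "M = relabel \<tau> M'" "M' \<in> set (one_object_tables 1 2 3)"
      using one_object_tables_relabel[of \<tau> 1 2 3] by (auto simp: \<tau>)
    let ?S = "(cat_comult M', cat_counit {1}) :: ('k, 3) wb_struct"
    have "?S \<in> set (map (\<lambda>M. (cat_comult M, cat_counit {1})) (one_object_tables 1 2 3))"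
      using M'(2) by simp
    then have "?S \<in> {B1, B2, B3, B4, B5, B6, B7}"
      unfolding function_structures_one_object by simp
    then show ?thesis using one[OF 1(1)] iso[OF M'(1), of "{1}"] 1(1) \<tau>(2) by simp
  next
    case 2
    then obtain M' where M': "M = relabel \<tau> M'" "M' \<in> set (two_object_tables 1 2 3)"
      using two_object_tables_relabel[of \<tau> 1 2 3] by (auto simp: \<tau>)
    let ?S = "(cat_comult M', cat_counit {1, 2}) :: ('k, 3) wb_struct"
    have "?S \<in> set (map (\<lambda>M. (cat_comult M, cat_counit {1, 2})) (two_object_tables 1 2 3))"
      using M'(2) by simp
    then have "?S \<in> {W2a, W2b, W2c}"
      unfolding function_structures_two_objects by simp
    then show ?thesis using two[OF 2(1)] iso[OF M'(1), of "{1, 2}"] 2(1) \<tau>(2,3) abc(1) by simp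
  next
    case 3
    have M: "M = relabel \<tau> (discrete_table 1 2 3)"
      using discrete_table_relabel[of \<tau> 1 2 3] 3(2) by (simp add: \<tau>)
    have "(cat_comult M, cat_counit A :: 'k ^ 3 \<Rightarrow> 'k) \<cong>\<^sub>w\<^sub>b W3"
      using iso[OF M, of "{1, 2, 3}"] 3(1) \<tau> by (simp add: function_structure_discrete)
    then show ?thesis using three 3(1) abc(2) by simp
  qed
qed

lemma three_arrow_categories_are_categories:
  fixes a b c :: "'n::finite"
  assumes "distinct [a, b, c]" and U: "UNIV = {a, b, c}"
    and X: "(M, A) \<in> set (three_arrow_categories a b c)"
  shows "arrow_category M A"
proof -
  have ne: "a \<noteq> b" "a \<noteq> c" "b \<noteq> c" "b \<noteq> a" "c \<noteq> a" "c \<noteq> b" using assms by auto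
  have all: "(\<forall>i. P i) \<longleftrightarrow> P a \<and> P b \<and> P c" for P using U by (metis UNIV_I empty_iff insert_iff)
  \<comment> \<open>The quantifiers over results of composition range over \<open>UNIV\<close> explicitly, so that only those
    over the factors are split into the three cases; simplification determines the results.\<close>
  have "(\<forall>i j. \<forall>k\<in>UNIV. \<forall>k'\<in>UNIV. (i, j, k) \<in> M \<longrightarrow> (i, j, k') \<in> M \<longrightarrow> k = k')
    \<and> (\<forall>i j k. \<forall>l\<in>UNIV. (\<exists>p. (i, j, p) \<in> M \<and> (p, k, l) \<in> M) \<longleftrightarrow> (\<exists>q. (j, k, q) \<in> M \<and> (i, q, l) \<in> M))
    \<and> (\<forall>i j k. \<forall>p\<in>UNIV. \<forall>q\<in>UNIV. (i, j, p) \<in> M \<longrightarrow> (j, k, q) \<in> M \<longrightarrow> (\<exists>l. (p, k, l) \<in> M))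
    \<and> (\<forall>k. \<exists>u\<in>A. (u, k, k) \<in> M) \<and> (\<forall>k. \<exists>u\<in>A. (k, u, k) \<in> M)
    \<and> (\<forall>k. \<forall>l\<in>UNIV. \<forall>u\<in>A. (u, k, l) \<in> M \<longrightarrow> l = k)
    \<and> (\<forall>k. \<forall>l\<in>UNIV. \<forall>u\<in>A. (k, u, l) \<in> M \<longrightarrow> l = k)"
    unfolding all using X
    unfolding three_arrow_defs list.map append.simps list.set prod.case insert_iff prod.inject empty_iff
    by - (elim disjE conjE FalseE; hypsubst_thin; simp add: ne)
  then show ?thesis
    unfolding arrow_category_def arrow_category_axioms_def partial_operation_def
    by simp blast
qed

text \<open>
  The number of composable pairs, of pairs with \<open>ij = i\<close>, and of pairs with \<open>ij = jj\<close>. The last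
  two treat the factors differently, which separates the left zeros from the right zeros.
\<close>
definition profile :: "('n \<times> 'n \<times> 'n) set \<Rightarrow> nat \<times> nat \<times> nat"
  where "profile M = (card M, \<Sum>(i, j, k)\<in>M. of_bool (k = i), \<Sum>(i, j, k)\<in>M. of_bool ((j, j, k) \<in> M))"

lemma profile_relabel:
  assumes "inj \<tau>"
  shows "profile (relabel \<tau> M) = profile M"
proof -
  let ?\<rho> = "\<lambda>(i, j, k). (\<tau> i, \<tau> j, \<tau> k)"
  have inj: "inj_on ?\<rho> M" by (auto intro!: inj_onI simp: inj_eq[OF assms])
  have "card (relabel \<tau> M) = card M" unfolding relabel_def by (rule card_image[OF inj])
  moreover have "(\<Sum>(i, j, k)\<in>relabel \<tau> M. of_bool (k = i)) = (\<Sum>(i, j, k)\<in>M. of_bool (k = i) :: nat)"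
    unfolding relabel_def sum.reindex[OF inj] using assms by (simp add: case_prod_unfold inj_eq)
  moreover have "(\<Sum>(i, j, k)\<in>relabel \<tau> M. of_bool ((j, j, k) \<in> relabel \<tau> M))
      = (\<Sum>(i, j, k)\<in>M. of_bool ((j, j, k) \<in> M) :: nat)"
    using mem_relabel[OF assms, of _ _ _ M] unfolding relabel_def sum.reindex[OF inj]
    by (simp add: case_prod_unfold)
  ultimately show ?thesis by (simp add: profile_def)
qed

lemma profiles:
  assumes "distinct [a, b, c]"
  shows "map (profile \<circ> fst) (three_arrow_categories a b c) =
    [(9, 3, 3), (9, 5, 5), (9, 7, 5), (9, 5, 7), (9, 6, 6), (9, 5, 6), (9, 5, 4),
     (4, 3, 2), (5, 4, 4), (5, 3, 3), (3, 3, 3)]"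
proof -
  have "a \<noteq> b" "a \<noteq> c" "b \<noteq> c" "b \<noteq> a" "c \<noteq> a" "c \<noteq> b" using assms by auto
  then show ?thesis by (simp add: three_arrow_defs profile_def)
qed

lemma card_wb_iso_classes:
  "card ((wb_structures :: ('k::field, 3) wb_struct set) // wb_iso_rel) = 11"
proof -
  let ?C = "three_arrow_categories 1 2 (3 :: 3)"
  let ?st = "\<lambda>(M, A). (cat_comult M, cat_counit A) :: ('k, 3) wb_struct"
  have d: "distinct [1, 2, 3 :: 3]" by simp
  have dist: "distinct (map (profile \<circ> fst) ?C)" unfolding profiles[OF d] by simp
  have len: "length ?C = 11" using arg_cong[OF profiles[OF d], of length] by simp
  have wb: "?st X \<in> wb_structures" if "X \<in> set ?C" for X
  proof -
    have "arrow_category (fst X) (snd X)"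
      using three_arrow_categories_are_categories[OF d UNIV_3] that
      by (simp add: list_all_iff case_prod_unfold)
    then show ?thesis unfolding wb_structures_eq case_prod_unfold by blast
  qed
  have sep: "X = Y" if X: "X \<in> set ?C" and Y: "Y \<in> set ?C" and iso: "(?st X, ?st Y) \<in> wb_iso_rel" for X Y
  proof -
    have "?st X \<cong>\<^sub>w\<^sub>b ?st Y" using iso by (simp add: wb_iso_rel_def)
    then have "profile (fst X) = profile (fst Y)"
      by (auto simp: case_prod_unfold cat_structs_isomorphic_iff profile_relabel bij_is_inj)
    then show ?thesis using dist X Y unfolding distinct_map inj_on_def by simp
  qed
  have refl: "(S, S) \<in> wb_iso_rel" if "S \<in> wb_structures" for S :: "('k, 3) wb_struct"
    using equiv_wb_iso_rel[where 'k = 'k and 'n = 3] that by (simp add: equiv_def refl_on_def)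
  have "card ((wb_structures :: ('k, 3) wb_struct set) // wb_iso_rel) = card (?st ` set ?C)"
  proof (rule card_quotient_representatives[OF equiv_wb_iso_rel])
    show "?st ` set ?C \<subseteq> wb_structures" using wb by blast
    fix S :: "('k, 3) wb_struct" assume S: "S \<in> wb_structures"
    then obtain M A where MA: "arrow_category M A" "S = (cat_comult M, cat_counit A)"
      unfolding wb_structures_eq by blast
    have R: "?st ` set ?C = {B1, B2, B3, B4, B5, B6, B7, W2a, W2b, W2c, W3}"
      using arg_cong[OF three_arrow_structures_eq, of set] by simp
    obtain T where T: "T \<in> ?st ` set ?C" "S \<cong>\<^sub>w\<^sub>b T"
      unfolding MA(2) R by (rule three_arrow_structure_cases[OF MA(1), where 'k = 'k]) blast+
    then have "T \<in> wb_structures" using wb by blast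
    then have "(S, T) \<in> wb_iso_rel" using S T(2) by (simp add: wb_iso_rel_def)
    then show "\<exists>T\<in>?st ` set ?C. (S, T) \<in> wb_iso_rel" using T(1) by blast
  next
    fix S T assume "S \<in> ?st ` set ?C" "T \<in> ?st ` set ?C" "(S, T) \<in> wb_iso_rel"
    then show "S = T" using sep by blast
  qed
  also have "\<dots> = card (set ?C)"
    by (intro card_image inj_onI sep) (use refl wb in force)+
  also have "\<dots> = 11" using dist len by (simp add: distinct_map distinct_card)
  finally show ?thesis .
qed

theorem theorem5p4:
  shows "(\<forall>(\<Delta> :: 'k::field ^ 3 \<Rightarrow> 'k ^ (3 \<times> 3)) (\<epsilon> :: 'k ^ 3 \<Rightarrow> 'k).
      weak_bialgebra \<Delta> \<epsilon> \<longrightarrow>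
        (let ds = vec.dim (source_subalgebra \<Delta> \<epsilon>); dt = vec.dim (target_subalgebra \<Delta> \<epsilon>) in
          ((ds = 1 \<and> dt = 1) \<or> (ds = 3 \<and> dt = 3) \<or> (ds = 2 \<and> dt = 2)) \<and>
          (\<exists>S \<in> {B1, B2, B3, B4, B5, B6, B7, W3, W2a, W2b, W2c}. (\<Delta>, \<epsilon>) \<cong>\<^sub>w\<^sub>b S) \<and>
          (ds = 1 \<and> dt = 1 \<longrightarrow>
             bialgebra \<Delta> \<epsilon> \<and> (\<exists>S \<in> {B1, B2, B3, B4, B5, B6, B7}. (\<Delta>, \<epsilon>) \<cong>\<^sub>w\<^sub>b S)) \<and>
          (ds = 3 \<and> dt = 3 \<longrightarrow> (\<forall>g \<in> {e1, e2, e3}. group_like \<Delta> \<epsilon> g)) \<and>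
          (ds = 2 \<and> dt = 2 \<longrightarrow> (\<exists>S \<in> {W2a, W2b, W2c}. (\<Delta>, \<epsilon>) \<cong>\<^sub>w\<^sub>b S)))) \<and>
    card ((wb_structures :: ('k, 3) wb_struct set) // wb_iso_rel) = 11"
proof (intro conjI allI impI card_wb_iso_classes)
  fix \<Delta> :: "'k ^ 3 \<Rightarrow> 'k ^ (3 \<times> 3)" and \<epsilon> :: "'k ^ 3 \<Rightarrow> 'k"
  assume "weak_bialgebra \<Delta> \<epsilon>"
  then obtain M A where cat: "arrow_category M A" and \<Delta>: "\<Delta> = cat_comult M" and \<epsilon>: "\<epsilon> = cat_counit A"
    by (rule category_of_weak_bialgebra)
  interpret arrow_category M A by (rule cat)
  have dims: "vec.dim (source_subalgebra \<Delta> \<epsilon>) = card A" "vec.dim (target_subalgebra \<Delta> \<epsilon>) = card A"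
    unfolding \<Delta> \<epsilon> by (rule dim_source_subalgebra dim_target_subalgebra)+
  show "let ds = vec.dim (source_subalgebra \<Delta> \<epsilon>); dt = vec.dim (target_subalgebra \<Delta> \<epsilon>) in
          ((ds = 1 \<and> dt = 1) \<or> (ds = 3 \<and> dt = 3) \<or> (ds = 2 \<and> dt = 2)) \<and>
          (\<exists>S \<in> {B1, B2, B3, B4, B5, B6, B7, W3, W2a, W2b, W2c}. (\<Delta>, \<epsilon>) \<cong>\<^sub>w\<^sub>b S) \<and>
          (ds = 1 \<and> dt = 1 \<longrightarrow>
             bialgebra \<Delta> \<epsilon> \<and> (\<exists>S \<in> {B1, B2, B3, B4, B5, B6, B7}. (\<Delta>, \<epsilon>) \<cong>\<^sub>w\<^sub>b S)) \<and>
          (ds = 3 \<and> dt = 3 \<longrightarrow> (\<forall>g \<in> {e1, e2, e3}. group_like \<Delta> \<epsilon> g)) \<and>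
          (ds = 2 \<and> dt = 2 \<longrightarrow> (\<exists>S \<in> {W2a, W2b, W2c}. (\<Delta>, \<epsilon>) \<cong>\<^sub>w\<^sub>b S))"
  proof (cases rule: three_arrow_structure_cases[OF cat, where 'k = 'k, case_names one two three])
    case (one a S)
    then have "bialgebra \<Delta> \<epsilon>" unfolding \<Delta> \<epsilon> by (intro bialgebra_of_one_object)
    moreover have "card A = 1" using one(1) by simp
    moreover have "(\<Delta>, \<epsilon>) \<cong>\<^sub>w\<^sub>b S" using one(3) by (simp add: \<Delta> \<epsilon>)
    ultimately show ?thesis unfolding Let_def dims using one(2) by auto
  next
    case (two a b S)
    have "card A = 2" using two(1,2) by simp
    moreover have "(\<Delta>, \<epsilon>) \<cong>\<^sub>w\<^sub>b S" using two(4) by (simp add: \<Delta> \<epsilon>)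
    ultimately show ?thesis unfolding Let_def dims using two(3) by auto
  next
    case three
    have "group_like \<Delta> \<epsilon> (axis u 1)" for u
      unfolding \<Delta> \<epsilon> using discrete_composition[OF three(1)] three(1)
      by (intro group_like_of_identity) auto
    moreover have "card A = 3" using three(1) by simp
    moreover have "(\<Delta>, \<epsilon>) \<cong>\<^sub>w\<^sub>b W3" using three(2) by (simp add: \<Delta> \<epsilon>)
    ultimately show ?thesis unfolding Let_def dims by auto
  qed
qed

end
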